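(* Let $\alpha>1$. There exists a smooth one-parameter family $\{\Omega_\varepsilon\}$ (indexed by small $\varepsilon>0$) of open bounded subsets of $\mathbb R^2$ such that: (i) $\partial\Omega_\varepsilon\in C^\alpha_{M,1/8}$ for some $M>0$ independent of $\varepsilon$; (ii) $B_{1-C_1\varepsilon}\subset\Omega_\varepsilon\subset B_{1+C_1\varepsilon}$ for a universal constant $C_1>0$; (iii) if $\pi_\lambda$ is the critical hyperplane of $\Omega_\varepsilon$ with respect to $e_1$, $\Omega_\varepsilon'$ is the reflection of $\Omega_\varepsilon$ across $\pi_\lambda$, and $\gamma\in(0,1/4)$, then $$\Big|\big\{x\in\Omega_\varepsilon\triangle\Omega_\varepsilon' : \operatorname{dist}(x,\pi_\lambda)\le\gamma\big\}\Big|\ge C_2\,\varepsilon^{1-\frac1\alpha}\qquad\text{as }\varepsilon\to0^+$$ (i.e. for all sufficiently small $\varepsilon>0$), where the constant $C_2>0$ depends on the dimension $n=2$ and on $\gamma$.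
   Context: $B_r$ denotes the open ball of radius $r$ centred at the origin; $|\cdot|$ of a set is Lebesgue measure. Critical hyperplane. For a bounded open set $\Omega\subset\mathbb R^n$ with $C^1$ boundary, $\mu\in\mathbb R$ and $e\in\mathbb S^{n-1}$, let $\pi_\mu=\{x: x\cdot e=\mu\}$ and let $\Omega'_\mu$ be the reflection across $\pi_\mu$ of $\Omega\cap\{x\cdot e>\mu\}$. Let $\Lambda=\sup\{x\cdot e: x\in\Omega\}$ and $\lambda=\inf\{\tilde\mu\in\mathbb R:\Omega'_\mu\subset\Omega\text{ for all }\mu\in(\tilde\mu,\Lambda)\}$. $\pi_\lambda$ is the critical hyperplane of $\Omega$ with respect to $e$. The class $C^\alpha_{M,\rho}$ ($\alpha>1$, $M,\rho>0$). For $\Omega\subset\mathbb R^n$ with $C^1$ boundary and $x\in\partial\Omega$, let $\nu(x)$ be the unit outward normal and $\Pi_x(y)=(y-x)-((y-x)\cdot\nu(x))\nu(x)$, with values in the tangent plane $T_x\partial\Omega$, identified with $\mathbb R^{n-1}$. For an open set $\Omega$ with $C^\alpha$ boundary, $\partial\Omega\in C^\alpha_{M,\rho}$ means that for all $x\in\partial\Omega$ there exists $\psi^{(x)}\in C^\alpha(B^{n-1}_\rho)$ with $\|\psi^{(x)}\|_{C^\alpha(B^{n-1}_\rho)}\le M$ and $B_\rho(x)\cap\Omega=\{y\in B_\rho(x): y\cdot\nu(x)<\psi^{(x)}(\Pi_x(y))\}$, where $B^{n-1}_\rho$ is the ball of radius $\rho$ centred at $0$ in $\mathbb R^{n-1}$.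 Here $C^\alpha=C^{k,\beta}$ with $k=\lfloor\alpha\rfloor$, $\beta=\alpha-k$ if $\alpha\notin\mathbb Z$, and $C^\alpha=C^{\alpha-1,1}$ if $\alpha\in\mathbb Z$. *)

theory Defs
  imports "HOL-Analysis.Analysis"
begin

subsection \<open>Hyperplanes, reflections and the critical hyperplane\<close>

definition hyperplane :: "'a::euclidean_space \<Rightarrow> real \<Rightarrow> 'a set" where
  "hyperplane e \<mu> = {x. x \<bullet> e = \<mu>}"

text \<open>The formula is the reflection across \<open>hyperplane e \<mu>\<close> only for unit vectors \<open>e\<close>.\<close>

definition reflection :: "'a::euclidean_space \<Rightarrow> real \<Rightarrow> 'a \<Rightarrow> 'a" where
  "reflection e \<mu> x = x - (2 * (x \<bullet> e - \<mu>)) *\<^sub>R e"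

definition reflected_cap :: "'a::euclidean_space set \<Rightarrow> 'a \<Rightarrow> real \<Rightarrow> 'a set" where
  "reflected_cap \<Omega> e \<mu> = reflection e \<mu> ` (\<Omega> \<inter> {x. x \<bullet> e > \<mu>})"

text \<open>For nonempty bounded \<open>\<Omega>\<close> the supremum and the infimum below are taken over nonempty sets that
  are bounded on the relevant side, so the real-valued \<open>Sup\<close> and \<open>Inf\<close> are the intended ones.\<close>

definition critical_value :: "'a::euclidean_space set \<Rightarrow> 'a \<Rightarrow> real" where
  "critical_value \<Omega> e =
     (let \<Lambda> = (SUP x\<in>\<Omega>. x \<bullet> e)
      in Inf {\<mu>'. \<forall>\<mu>\<in>{\<mu>'<..<\<Lambda>}. reflected_cap \<Omega> e \<mu> \<subseteq> \<Omega>})"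

subsection \<open>Outward normals\<close>

text \<open>Near \<open>x\<close>, the set \<open>\<Omega>\<close> is the sublevel set of a \<open>C\<^sup>1\<close> function with nowhere vanishing gradient,
  and \<open>\<nu>\<close> is its normalised gradient at \<open>x\<close>. An open \<open>\<Omega>\<close> has \<open>C\<^sup>1\<close> boundary iff such a \<open>\<nu>\<close>
  (then unique) exists at every boundary point.\<close>

definition outward_unit_normal :: "'a::euclidean_space set \<Rightarrow> 'a \<Rightarrow> 'a \<Rightarrow> bool" where
  "outward_unit_normal \<Omega> x \<nu> \<longleftrightarrow> x \<in> frontier \<Omega> \<and>
     (\<exists>U f g. open U \<and> x \<in> U \<and>
        (\<forall>y\<in>U. GDERIV f y :> g y \<and> g y \<noteq> 0) \<and> continuous_on U g \<and>
        \<Omega> \<inter> U = {y \<in> U. f y < 0} \<and>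
        \<nu> = sgn (g x))"

subsection \<open>Hoelder spaces on open sets of the real line\<close>

definition Ck_holder_norm :: "nat \<Rightarrow> real \<Rightarrow> real set \<Rightarrow> (real \<Rightarrow> real) \<Rightarrow> ennreal" where
  "Ck_holder_norm k \<beta> S f =
     (\<Sum>j\<le>k. SUP s\<in>S. ennreal \<bar>(deriv ^^ j) f s\<bar>) +
     (SUP s\<in>S. SUP t\<in>S - {s}.
        ennreal (\<bar>(deriv ^^ k) f s - (deriv ^^ k) f t\<bar> / \<bar>s - t\<bar> powr \<beta>))"

definition Ck_holder_on :: "nat \<Rightarrow> real \<Rightarrow> real set \<Rightarrow> (real \<Rightarrow> real) \<Rightarrow> bool" where
  "Ck_holder_on k \<beta> S f \<longleftrightarrow>
     (\<forall>j<k. \<forall>s\<in>S. (deriv ^^ j) f differentiable (at s)) \<and>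
     continuous_on S ((deriv ^^ k) f) \<and>
     Ck_holder_norm k \<beta> S f < \<infinity>"

text \<open>\<open>C\<^sup>\<alpha>\<close> means \<open>C\<^sup>k\<^sup>,\<^sup>\<beta>\<close> with the following \<open>k\<close> and \<open>\<beta>\<close>; in particular it is \<open>C\<^sup>\<alpha>\<^sup>-\<^sup>1\<^sup>,\<^sup>1\<close>, not \<open>C\<^sup>\<alpha>\<^sup>,\<^sup>0\<close>,
  for integral \<open>\<alpha>\<close>.\<close>

definition holder_order :: "real \<Rightarrow> nat" where
  "holder_order \<alpha> = (if \<alpha> \<in> \<int> then nat \<lfloor>\<alpha>\<rfloor> - 1 else nat \<lfloor>\<alpha>\<rfloor>)"

definition holder_exponent :: "real \<Rightarrow> real" where
  "holder_exponent \<alpha> = (if \<alpha> \<in> \<int> then 1 else \<alpha> - of_int \<lfloor>\<alpha>\<rfloor>)"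

definition C_alpha_on :: "real \<Rightarrow> real set \<Rightarrow> (real \<Rightarrow> real) \<Rightarrow> bool" where
  "C_alpha_on \<alpha> = Ck_holder_on (holder_order \<alpha>) (holder_exponent \<alpha>)"

definition C_alpha_norm :: "real \<Rightarrow> real set \<Rightarrow> (real \<Rightarrow> real) \<Rightarrow> ennreal" where
  "C_alpha_norm \<alpha> = Ck_holder_norm (holder_order \<alpha>) (holder_exponent \<alpha>)"

subsection \<open>Planar sets with boundary in the class \<open>C\<^sup>\<alpha>\<close> with parameters \<open>M\<close>, \<open>\<rho>\<close>\<close>

definition tangent_projection :: "'a::euclidean_space \<Rightarrow> 'a \<Rightarrow> 'a \<Rightarrow> 'a" where
  "tangent_projection \<nu> x y = (y - x) - ((y - x) \<bullet> \<nu>) *\<^sub>R \<nu>"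

text \<open>The tangent line at \<open>x\<close> is identified with the real line through a unit tangent vector \<open>\<tau>\<close>, which
  makes \<open>tangent_projection \<nu> x y \<bullet> \<tau>\<close> the coordinate of the projection. The choice between \<open>\<tau>\<close> and
  \<open>- \<tau>\<close> is immaterial, since \<open>\<psi>\<close> and \<open>\<lambda>t. \<psi> (- t)\<close> have the same norm. The graph condition also
  says that the boundary is locally the graph of a \<open>C\<^sup>\<alpha>\<close> function, so a separate requirement of a
  \<open>C\<^sup>\<alpha>\<close> boundary would be redundant.\<close>

definition boundary_in_C_alpha :: "real \<Rightarrow> real \<Rightarrow> real \<Rightarrow> (real^2) set \<Rightarrow> bool" where
  "boundary_in_C_alpha \<alpha> M \<rho> \<Omega> \<longleftrightarrow> open \<Omega> \<and>
     (\<forall>x\<in>frontier \<Omega>. \<exists>\<nu> \<tau> \<psi>.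
        outward_unit_normal \<Omega> x \<nu> \<and> norm \<tau> = 1 \<and> \<tau> \<bullet> \<nu> = 0 \<and>
        C_alpha_on \<alpha> (ball 0 \<rho>) \<psi> \<and> C_alpha_norm \<alpha> (ball 0 \<rho>) \<psi> \<le> ennreal M \<and>
        ball x \<rho> \<inter> \<Omega> = {y \<in> ball x \<rho>. y \<bullet> \<nu> < \<psi> (tangent_projection \<nu> x y \<bullet> \<tau>)})"

subsection \<open>Smooth one-parameter families of sets\<close>

text \<open>Intended for open sets, where the values of the Frechet derivative outside \<open>S\<close> play no role.\<close>

fun Ck_on :: "nat \<Rightarrow> 'a::euclidean_space set \<Rightarrow> ('a \<Rightarrow> real) \<Rightarrow> bool" where
  "Ck_on 0 S f \<longleftrightarrow> continuous_on S f"
| "Ck_on (Suc k) S f \<longleftrightarrow>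
     (\<forall>x\<in>S. f differentiable (at x)) \<and>
     (\<forall>b\<in>Basis. Ck_on k S (\<lambda>x. frechet_derivative f (at x) b))"

definition smooth_on :: "'a::euclidean_space set \<Rightarrow> ('a \<Rightarrow> real) \<Rightarrow> bool" where
  "smooth_on S f \<longleftrightarrow> (\<forall>k. Ck_on k S f)"

text \<open>The sets are the sublevel sets of a function that is smooth jointly in the parameter and the point,
  and whose gradient in the space variables does not vanish on its zero set. Thus the boundaries are
  smooth hypersurfaces that depend smoothly on the parameter.\<close>

definition smooth_set_family :: "real set \<Rightarrow> (real \<Rightarrow> 'a::euclidean_space set) \<Rightarrow> bool" where
  "smooth_set_family I \<Omega> \<longleftrightarrow>
     (\<exists>F :: real \<times> 'a \<Rightarrow> real. smooth_on (I \<times> UNIV) F \<and>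
        (\<forall>\<epsilon>\<in>I. \<Omega> \<epsilon> = {x. F (\<epsilon>, x) < 0} \<and>
           (\<forall>x. F (\<epsilon>, x) = 0 \<longrightarrow> \<not> (GDERIV (\<lambda>y. F (\<epsilon>, y)) x :> 0))))"

end

theory Submission
  imports Defs
begin

text \<open>The set \<open>\<Omega>\<^sub>\<epsilon>\<close> is the unit disc sheared vertically by the wave
  \<open>G(u) = \<epsilon> sin ((u - p) / d)\<close> with \<open>d = \<epsilon> powr (1 / \<alpha>)\<close> and \<open>p = \<epsilon> powr (1 - 1 / \<alpha>) / 4\<close>.
  Amplitude \<open>\<epsilon> = d powr \<alpha>\<close> and wavelength \<open>d\<close> make the wave bounded in \<open>C\<^sup>\<alpha>\<close>, while its slope at \<open>p\<close> is
  \<open>4 p\<close>. So the upper boundary ascends at \<open>p\<close>, and the moving planes stop at some \<open>\<lambda> \<ge> p\<close>.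
  A vertical shear does not change the lengths of vertical sections: those at distance \<open>t\<close> to the left
  and to the right of the critical line differ by at least a multiple of \<open>\<lambda> t\<close>, as in the disc.
  Integrating over \<open>\<gamma> / 2 < t < \<gamma>\<close> bounds the asymmetry below by \<open>\<lambda> \<gamma>\<^sup>2 / 2\<close>.\<close>

subsection \<open>Smooth functions of several variables\<close>

text \<open>The rate is the ratio of amplitude to wavelength: the circle descends at
  \<open>p\<close> with slope about \<open>- p\<close>, so a wave that ascends there carries the
  critical line out to a distance proportional to its own slope. The exact \<open>\<lambda>\<close>
  stays unknown; only \<open>p \<le> \<lambda> \<le> 1\<close> is established. The asymmetry is
  therefore estimated for every vertical line in that range, and a shear makes this possible because
  the estimate then depends on chord lengths of the disc alone. The main obstacle is the class of
  the boundary. It asks for a graph over the tangent line in a ball whose radius does not shrink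
  with the wavelength, also where the tangent is vertical. So the boundary is parametrised by the
  angle, and the graph function becomes \<open>Y\<close> composed with the inverse of
  \<open>X\<close>. Its norm is controlled by closing uniformly bounded Hoelder families under sums,
  products, reciprocals and inverse functions, with the pairs of \<epsilon> and base angle as index.
  The geometry uses only that the wave has slope at most 1/100, hence its constants do not depend on
  \<epsilon>.\<close>

lemma Ck_on_cong:
  assumes "open S" "\<And>x. x \<in> S \<Longrightarrow> f x = g x" "Ck_on k S f"
  shows "Ck_on k S g"
  using assms(2,3)
proof (induction k arbitrary: f g)
  case 0
  then show ?case by (metis (no_types, lifting) Ck_on.simps(1) continuous_on_cong)
next
  case (Suc k)
  have d: "(g has_derivative frechet_derivative f (at x)) (at x)" if "x \<in> S" for x
  proof -
    have "(f has_derivative frechet_derivative f (at x)) (at x)"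
      using Suc.prems(2) that frechet_derivative_works by auto
    then show ?thesis
      using has_derivative_transform_within_open[OF _ assms(1) that] Suc.prems(1) by metis
  qed
  then have e: "frechet_derivative g (at x) = frechet_derivative f (at x)" if "x \<in> S" for x
    using that frechet_derivative_at by metis
  show ?case
    using Suc.IH[of "\<lambda>x. frechet_derivative f (at x) b" "\<lambda>x. frechet_derivative g (at x) b" for b]
      Suc.prems(2) d e by (auto simp: differentiable_def)
qed

text \<open>\<open>Ck_on\<close> refers to the chosen derivative \<open>frechet_derivative\<close>.
  By uniqueness of derivatives on an open set, any explicit formula may replace it, which the
  closure rules below rely on.\<close>

lemma Ck_on_SucI:
  assumes "open S" "\<And>x. x \<in> S \<Longrightarrow> (f has_derivative f' x) (at x)"
    and "\<And>b. b \<in> Basis \<Longrightarrow> Ck_on k S (\<lambda>x. f' x b)"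
  shows "Ck_on (Suc k) S f"
proof -
  have "frechet_derivative f (at x) = f' x" if "x \<in> S" for x
    using assms(2)[OF that] frechet_derivative_at by metis
  then have "Ck_on k S (\<lambda>x. frechet_derivative f (at x) b)" if "b \<in> Basis" for b
    using Ck_on_cong[OF assms(1) _ assms(3)[OF that]] by simp
  with assms(2) show ?thesis by (auto simp: differentiable_def)
qed

lemma Ck_on_SucD:
  assumes "Ck_on (Suc k) S f" "open S"
  shows "Ck_on k S f"
  using assms(1)
proof (induction k arbitrary: f)
  case 0
  then show ?case
    by (metis Ck_on.simps continuous_at_imp_continuous_on differentiable_imp_continuous_within)
next
  case (Suc k)
  then show ?case by (metis Ck_on.simps(2))
qed

lemma Ck_on_const: "open S \<Longrightarrow> Ck_on k S (\<lambda>x. c)"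
proof (induction k arbitrary: c)
  case (Suc k)
  then show ?case by (intro Ck_on_SucI[where f' = "\<lambda>_ _. 0"]) auto
qed auto

lemma Ck_on_linear:
  assumes "open S" "bounded_linear f"
  shows "Ck_on k S f"
proof (cases k)
  case 0
  then show ?thesis using assms(2) by (simp add: linear_continuous_on)
next
  case (Suc n)
  show ?thesis unfolding Suc
    by (rule Ck_on_SucI[where f' = "\<lambda>_. f"])
      (use assms in \<open>auto simp: bounded_linear_imp_has_derivative Ck_on_const\<close>)
qed

lemma Ck_on_add:
  assumes "open S" "Ck_on k S f" "Ck_on k S g"
  shows "Ck_on k S (\<lambda>x. f x + g x)"
  using assms(2,3)
proof (induction k arbitrary: f g)
  case 0
  then show ?case by (auto intro: continuous_intros)
next
  case (Suc k)
  then show ?case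
    by (intro Ck_on_SucI[where f' = "\<lambda>x b. frechet_derivative f (at x) b + frechet_derivative g (at x) b"])
      (auto simp: assms(1) frechet_derivative_works intro!: derivative_eq_intros)
qed

lemma Ck_on_mult:
  assumes "open S" "Ck_on k S f" "Ck_on k S g"
  shows "Ck_on k S (\<lambda>x. f x * g x)"
  using assms(2,3)
proof (induction k arbitrary: f g)
  case 0
  then show ?case by (auto intro: continuous_intros)
next
  case (Suc k)
  have fg: "Ck_on k S f" "Ck_on k S g"
    using Suc.prems Ck_on_SucD assms(1) by blast+
  show ?case
  proof (intro Ck_on_SucI[where f' = "\<lambda>x b. f x * frechet_derivative g (at x) b + frechet_derivative f (at x) b * g x"])
    show "((\<lambda>x. f x * g x) has_derivative (\<lambda>b. f x * frechet_derivative g (at x) b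
        + frechet_derivative f (at x) b * g x)) (at x)" if "x \<in> S" for x
      using Suc.prems that by (intro has_derivative_mult) (auto simp: frechet_derivative_works)
    show "Ck_on k S (\<lambda>x. f x * frechet_derivative g (at x) b + frechet_derivative f (at x) b * g x)"
      if "b \<in> Basis" for b
      using Suc that fg by (intro Ck_on_add assms(1)) auto
  qed (rule assms(1))
qed

text \<open>Both claims go through one induction, since each function occurs in the derivative of
  the other.\<close>

lemma Ck_on_sin_cos:
  assumes "open S" "Ck_on k S f"
  shows "Ck_on k S (\<lambda>x. sin (f x)) \<and> Ck_on k S (\<lambda>x. cos (f x))"
  using assms(2)
proof (induction k)
  case 0
  then show ?case by (auto intro: continuous_intros)
next
  case (Suc k)
  then have IH: "Ck_on k S (\<lambda>x. sin (f x))" "Ck_on k S (\<lambda>x. cos (f x))"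
    using Ck_on_SucD assms(1) by blast+
  have d: "(f has_derivative frechet_derivative f (at x)) (at x)" if "x \<in> S" for x
    using Suc.prems that by (auto simp: frechet_derivative_works)
  have m: "Ck_on k S (\<lambda>x. c * frechet_derivative f (at x) b)" if "b \<in> Basis" for b c
    using Suc.prems that by (intro Ck_on_mult Ck_on_const assms(1)) auto
  have "Ck_on (Suc k) S (\<lambda>x. sin (f x))"
  \<comment> \<open>The factor \<open>1\<close>, like \<open>- 1\<close> in the cosine case, gives
    the derivative the shape covered by \<open>m\<close>.\<close>
  proof (rule Ck_on_SucI[where f' = "\<lambda>x b. cos (f x) * (1 * frechet_derivative f (at x) b)"])
    show "((\<lambda>x. sin (f x)) has_derivative (\<lambda>b. cos (f x) * (1 * frechet_derivative f (at x) b))) (at x)"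
      if "x \<in> S" for x
      using d[OF that] by (auto intro!: derivative_eq_intros)
    show "Ck_on k S (\<lambda>x. cos (f x) * (1 * frechet_derivative f (at x) b))" if "b \<in> Basis" for b
      by (rule Ck_on_mult[OF assms(1) IH(2) m[OF that]])
  qed (rule assms(1))
  moreover have "Ck_on (Suc k) S (\<lambda>x. cos (f x))"
  proof (rule Ck_on_SucI[where f' = "\<lambda>x b. sin (f x) * (- 1 * frechet_derivative f (at x) b)"])
    show "((\<lambda>x. cos (f x)) has_derivative (\<lambda>b. sin (f x) * (- 1 * frechet_derivative f (at x) b))) (at x)"
      if "x \<in> S" for x
      using d[OF that] by (auto intro!: derivative_eq_intros)
    show "Ck_on k S (\<lambda>x. sin (f x) * (- 1 * frechet_derivative f (at x) b))" if "b \<in> Basis" for b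
      by (rule Ck_on_mult[OF assms(1) IH(1) m[OF that]])
  qed (rule assms(1))
  ultimately show ?case ..
qed

text \<open>Differentiation lowers the exponent by one, so the induction runs over all real
  exponents at once; positivity of the base keeps every one of them smooth.\<close>

lemma Ck_on_powr:
  fixes f :: "'a::euclidean_space \<Rightarrow> real"
  assumes "open S" "Ck_on k S f" "\<And>x. x \<in> S \<Longrightarrow> f x > 0"
  shows "Ck_on k S (\<lambda>x. f x powr a)"
  using assms(2)
proof (induction k arbitrary: a)
  case 0
  then show ?case using assms(3) by (force intro!: continuous_intros)
next
  case (Suc k)
  show ?case
  proof (rule Ck_on_SucI[where f' = "\<lambda>x b. f x powr (a - 1) * (a * frechet_derivative f (at x) b)"])
    show "((\<lambda>x. f x powr a) has_derivative
        (\<lambda>b. f x powr (a - 1) * (a * frechet_derivative f (at x) b))) (at x)" if "x \<in> S" for x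
    proof -
      have d: "(f has_derivative frechet_derivative f (at x)) (at x)"
        using Suc.prems that by (auto simp: frechet_derivative_works)
      have "((\<lambda>u. u powr a) has_real_derivative a * f x powr (a - 1)) (at (f x))"
        using assms(3)[OF that] by (auto intro!: derivative_eq_intros simp: powr_diff)
      from has_derivative_compose[OF d this[unfolded has_field_derivative_def]]
      show ?thesis by (simp add: mult_ac)
    qed
    show "Ck_on k S (\<lambda>x. f x powr (a - 1) * (a * frechet_derivative f (at x) b))" if "b \<in> Basis" for b
      using Suc.prems that Suc.IH[of "a - 1"] Ck_on_SucD[OF Suc.prems assms(1)]
      by (intro Ck_on_mult Ck_on_const assms(1)) auto
  qed (rule assms(1))
qed

subsection \<open>Families bounded in a Hoelder space\<close>

lemma deriv_iterate_cong:
  fixes f g :: "real \<Rightarrow> real"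
  assumes "open S" "\<And>s. s \<in> S \<Longrightarrow> f s = g s" "s \<in> S"
  shows "(deriv ^^ j) f s = (deriv ^^ j) g s"
  using assms(3)
proof (induction j arbitrary: s)
  case 0
  then show ?case using assms(2) by simp
next
  case (Suc j)
  have "eventually (\<lambda>u. u \<in> S) (nhds s)"
    using Suc.prems assms(1) eventually_nhds_in_open by blast
  then have "eventually (\<lambda>u. (deriv ^^ j) f u = (deriv ^^ j) g u) (nhds s)"
    by (rule eventually_mono) (use Suc.IH in auto)
  then show ?case by (auto intro: deriv_cong_ev)
qed

text \<open>Boundedness in \<open>C\<^sup>n\<^sup>,\<^sup>\<beta>(S)\<close>, uniformly in the index. The recursion over \<open>n\<close> avoids iterated
  derivatives of products and compositions.\<close>

primrec holder_family :: "'i set \<Rightarrow> real \<Rightarrow> real set \<Rightarrow> nat \<Rightarrow> ('i \<Rightarrow> real \<Rightarrow> real) \<Rightarrow> bool" where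
  "holder_family P \<beta> S 0 f \<longleftrightarrow> (\<exists>C. \<forall>i\<in>P. \<forall>s\<in>S. \<bar>f i s\<bar> \<le> C) \<and>
     (\<exists>C. \<forall>i\<in>P. \<forall>s\<in>S. \<forall>t\<in>S. \<bar>f i s - f i t\<bar> \<le> C * \<bar>s - t\<bar> powr \<beta>)"
| "holder_family P \<beta> S (Suc n) f \<longleftrightarrow> (\<exists>C. \<forall>i\<in>P. \<forall>s\<in>S. \<bar>f i s\<bar> \<le> C) \<and>
     (\<exists>f'. (\<forall>i\<in>P. \<forall>s\<in>S. (f i has_real_derivative f' i s) (at s)) \<and> holder_family P \<beta> S n f')"

lemma holder_family_bounded:
  assumes "holder_family P \<beta> S n f"
  obtains C where "C > 0" "\<And>i s. i \<in> P \<Longrightarrow> s \<in> S \<Longrightarrow> \<bar>f i s\<bar> \<le> C"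
proof -
  obtain C where "\<forall>i\<in>P. \<forall>s\<in>S. \<bar>f i s\<bar> \<le> C" using assms by (cases n) auto
  then have "\<bar>f i s\<bar> \<le> max C 1" if "i \<in> P" "s \<in> S" for i s using that by force
  then show ?thesis using that[of "max C 1"] by simp
qed

lemma holder_family_0I:
  assumes "\<And>i s. i \<in> P \<Longrightarrow> s \<in> S \<Longrightarrow> \<bar>f i s\<bar> \<le> A"
    and "\<And>i s t. i \<in> P \<Longrightarrow> s \<in> S \<Longrightarrow> t \<in> S \<Longrightarrow> \<bar>f i s - f i t\<bar> \<le> B * \<bar>s - t\<bar> powr \<beta>"
  shows "holder_family P \<beta> S 0 f"
  unfolding holder_family.simps using assms by blast

lemma holder_family_0E:
  assumes "holder_family P \<beta> S 0 f"
  obtains A B where "A > 0" "B > 0" "\<And>i s. i \<in> P \<Longrightarrow> s \<in> S \<Longrightarrow> \<bar>f i s\<bar> \<le> A"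
    "\<And>i s t. i \<in> P \<Longrightarrow> s \<in> S \<Longrightarrow> t \<in> S \<Longrightarrow> \<bar>f i s - f i t\<bar> \<le> B * \<bar>s - t\<bar> powr \<beta>"
proof -
  obtain B where B: "\<forall>i\<in>P. \<forall>s\<in>S. \<forall>t\<in>S. \<bar>f i s - f i t\<bar> \<le> B * \<bar>s - t\<bar> powr \<beta>"
    using assms by auto
  obtain A where A: "A > 0" "\<And>i s. i \<in> P \<Longrightarrow> s \<in> S \<Longrightarrow> \<bar>f i s\<bar> \<le> A"
    using assms holder_family_bounded by metis
  have "B * r powr \<beta> \<le> max B 1 * r powr \<beta>" for r by (intro mult_right_mono) auto
  then have "\<bar>f i s - f i t\<bar> \<le> max B 1 * \<bar>s - t\<bar> powr \<beta>" if "i \<in> P" "s \<in> S" "t \<in> S" for i s t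
    using B that order_trans by blast
  with A that[of A "max B 1"] show ?thesis by simp
qed

lemma holder_family_SucI:
  assumes "\<And>i s. i \<in> P \<Longrightarrow> s \<in> S \<Longrightarrow> \<bar>f i s\<bar> \<le> C"
    and "\<And>i s. i \<in> P \<Longrightarrow> s \<in> S \<Longrightarrow> (f i has_real_derivative f' i s) (at s)"
    and "holder_family P \<beta> S n f'"
  shows "holder_family P \<beta> S (Suc n) f"
  unfolding holder_family.simps using assms by blast

lemma holder_family_SucE:
  assumes "holder_family P \<beta> S (Suc n) f"
  obtains f' where "\<And>i s. i \<in> P \<Longrightarrow> s \<in> S \<Longrightarrow> (f i has_real_derivative f' i s) (at s)"
    "holder_family P \<beta> S n f'"
  using assms unfolding holder_family.simps by blast

lemma holder_family_cong:
  assumes "open S" "\<And>i s. i \<in> P \<Longrightarrow> s \<in> S \<Longrightarrow> f i s = g i s" "holder_family P \<beta> S n f"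
  shows "holder_family P \<beta> S n g"
proof (cases n)
  case 0
  then show ?thesis using assms by simp
next
  case (Suc m)
  then obtain f' where f': "\<And>i s. i \<in> P \<Longrightarrow> s \<in> S \<Longrightarrow> (f i has_real_derivative f' i s) (at s)"
    "holder_family P \<beta> S m f'" using holder_family_SucE assms(3) by metis
  have "(g i has_real_derivative f' i s) (at s)" if "i \<in> P" "s \<in> S" for i s
    using has_field_derivative_transform_within_open[OF f'(1)[OF that] assms(1) that(2)] assms(2) that(1)
    by metis
  moreover obtain C where "\<And>i s. i \<in> P \<Longrightarrow> s \<in> S \<Longrightarrow> \<bar>f i s\<bar> \<le> C"
    using holder_family_bounded[OF assms(3)] by metis
  ultimately show ?thesis unfolding Suc
    using assms(2) f'(2) by (intro holder_family_SucI[of P S g C f']) auto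
qed

text \<open>The derivative in \<open>holder_family\<close> is existentially quantified; uniqueness
  of derivatives transfers the bounds to the one at hand.\<close>

lemma holder_family_derivative:
  assumes "open S" "holder_family P \<beta> S (Suc n) f"
    and "\<And>i s. i \<in> P \<Longrightarrow> s \<in> S \<Longrightarrow> (f i has_real_derivative f' i s) (at s)"
  shows "holder_family P \<beta> S n f'"
proof -
  obtain h where h: "\<And>i s. i \<in> P \<Longrightarrow> s \<in> S \<Longrightarrow> (f i has_real_derivative h i s) (at s)"
    "holder_family P \<beta> S n h" using holder_family_SucE[OF assms(2)] by metis
  show ?thesis
    by (rule holder_family_cong[OF assms(1) _ h(2)]) (use h(1) assms(3) DERIV_unique in blast)
qed

text \<open>Convexity serves the mean value theorem. Diameter at most 1 gives
  \<open>r \<le> r powr \<beta>\<close> for all distances \<open>r\<close>, so a Lipschitz bound is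
  a Hoelder bound with the same constant.\<close>

locale holder_domain =
  fixes P :: "'i set" and \<beta> :: real and S :: "real set"
  assumes \<beta>: "0 < \<beta>" "\<beta> \<le> 1"
    and S: "open S" "convex S" "\<And>s t. s \<in> S \<Longrightarrow> t \<in> S \<Longrightarrow> \<bar>s - t\<bar> \<le> 1"
begin

abbreviation "H \<equiv> holder_family P \<beta> S"

lemma lipschitz_holder:
  assumes "s \<in> S" "t \<in> S" "\<bar>u\<bar> \<le> C * \<bar>s - t\<bar>" "C \<ge> 0"
  shows "\<bar>u\<bar> \<le> C * \<bar>s - t\<bar> powr \<beta>"
proof (cases "s = t")
  case False
  have "\<bar>s - t\<bar> powr 1 \<le> \<bar>s - t\<bar> powr \<beta>"
    using S(3)[OF assms(1,2)] \<beta> by (intro powr_mono') auto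
  then have "\<bar>s - t\<bar> \<le> \<bar>s - t\<bar> powr \<beta>" by simp
  then show ?thesis using assms(3,4) by (meson mult_left_mono order_trans)
qed (use assms in auto)

lemma mean_value_bound:
  assumes "\<And>s. s \<in> S \<Longrightarrow> (f has_real_derivative f' s) (at s)"
    and "\<And>s. s \<in> S \<Longrightarrow> \<bar>f' s\<bar> \<le> C" "s \<in> S" "t \<in> S"
  shows "\<bar>f s - f t\<bar> \<le> C * \<bar>s - t\<bar>"
  using field_differentiable_bound[OF S(2), of f f' C s t] assms
  by (auto intro: has_field_derivative_at_within simp: abs_minus_commute)

text \<open>The only real work is at the bottom, where a bounded first derivative has to yield a
  Hoelder bound; higher orders follow by passing to derivatives.\<close>

lemma mono:
  assumes "H n f" "m \<le> n"
  shows "H m f"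
proof -
  have step: "H k f" if "H (Suc k) f" for k f
    using that
  proof (induction k arbitrary: f)
    case 0
    then obtain f' where f': "\<And>i s. i \<in> P \<Longrightarrow> s \<in> S \<Longrightarrow> (f i has_real_derivative f' i s) (at s)" "H 0 f'"
      using holder_family_SucE by metis
    then obtain C where C: "C > 0" "\<And>i s. i \<in> P \<Longrightarrow> s \<in> S \<Longrightarrow> \<bar>f' i s\<bar> \<le> C"
      using holder_family_bounded by metis
    have "\<bar>f i s - f i t\<bar> \<le> C * \<bar>s - t\<bar> powr \<beta>" if "i \<in> P" "s \<in> S" "t \<in> S" for i s t
      using that C f'(1) mean_value_bound[of "f i" "f' i" C s t] lipschitz_holder[of s t _ C] by force
    moreover obtain A where "\<And>i s. i \<in> P \<Longrightarrow> s \<in> S \<Longrightarrow> \<bar>f i s\<bar> \<le> A"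
      using holder_family_bounded[OF 0] by metis
    ultimately show ?case by (intro holder_family_0I)
  next
    case (Suc k f)
    obtain C where C: "\<And>i s. i \<in> P \<Longrightarrow> s \<in> S \<Longrightarrow> \<bar>f i s\<bar> \<le> C"
      by (rule holder_family_bounded[OF Suc.prems]) (rule that)
    obtain f' where f': "\<And>i s. i \<in> P \<Longrightarrow> s \<in> S \<Longrightarrow> (f i has_real_derivative f' i s) (at s)"
      "H (Suc k) f'" by (rule holder_family_SucE[OF Suc.prems]) (rule that)
    show ?case by (rule holder_family_SucI[OF C f'(1) Suc.IH[OF f'(2)]])
  qed
  show ?thesis using assms
  proof (induction n)
    case (Suc n)
    show ?case
    proof (cases "m = Suc n")
      case True
      then show ?thesis using Suc.prems(1) by (simp only:)
    next
      case False
      then have "m \<le> n" using Suc.prems(2) by simp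
      then show ?thesis by (rule Suc.IH[OF step[OF Suc.prems(1)]])
    qed
  qed simp
qed

lemma const:
  assumes "\<And>i. i \<in> P \<Longrightarrow> \<bar>c i\<bar> \<le> C"
  shows "H n (\<lambda>i s. c i)"
proof -
  have zero: "H n (\<lambda>i s. 0)" for n
    by (induction n) (auto intro!: exI[of _ 0] exI[of _ "\<lambda>i s. 0"])
  show ?thesis
  proof (cases n)
    case 0
    show ?thesis unfolding 0 by (rule holder_family_0I[OF assms, where B = 0]) auto
  next
    case (Suc m)
    show ?thesis unfolding Suc by (rule holder_family_SucI[OF assms _ zero]) auto
  qed
qed

lemma add:
  assumes "H n f" "H n g"
  shows "H n (\<lambda>i s. f i s + g i s)"
  using assms
proof (induction n arbitrary: f g)
  case 0
  obtain A B where A: "\<And>i s. i \<in> P \<Longrightarrow> s \<in> S \<Longrightarrow> \<bar>f i s\<bar> \<le> A"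
    "\<And>i s t. i \<in> P \<Longrightarrow> s \<in> S \<Longrightarrow> t \<in> S \<Longrightarrow> \<bar>f i s - f i t\<bar> \<le> B * \<bar>s - t\<bar> powr \<beta>"
    using holder_family_0E[OF 0(1)] by metis
  obtain A' B' where A': "\<And>i s. i \<in> P \<Longrightarrow> s \<in> S \<Longrightarrow> \<bar>g i s\<bar> \<le> A'"
    "\<And>i s t. i \<in> P \<Longrightarrow> s \<in> S \<Longrightarrow> t \<in> S \<Longrightarrow> \<bar>g i s - g i t\<bar> \<le> B' * \<bar>s - t\<bar> powr \<beta>"
    using holder_family_0E[OF 0(2)] by metis
  show ?case
  proof (rule holder_family_0I[where A = "A + A'" and B = "B + B'"])
    show "\<bar>f i s + g i s\<bar> \<le> A + A'" if "i \<in> P" "s \<in> S" for i s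
      using A(1)[OF that] A'(1)[OF that] by linarith
    show "\<bar>f i s + g i s - (f i t + g i t)\<bar> \<le> (B + B') * \<bar>s - t\<bar> powr \<beta>"
      if "i \<in> P" "s \<in> S" "t \<in> S" for i s t
      unfolding distrib_right using A(2)[OF that] A'(2)[OF that] by linarith
  qed
next
  case (Suc n)
  obtain f' where f': "\<And>i s. i \<in> P \<Longrightarrow> s \<in> S \<Longrightarrow> (f i has_real_derivative f' i s) (at s)" "H n f'"
    using holder_family_SucE[OF Suc.prems(1)] by metis
  obtain g' where g': "\<And>i s. i \<in> P \<Longrightarrow> s \<in> S \<Longrightarrow> (g i has_real_derivative g' i s) (at s)" "H n g'"
    using holder_family_SucE[OF Suc.prems(2)] by metis
  obtain A where A: "\<And>i s. i \<in> P \<Longrightarrow> s \<in> S \<Longrightarrow> \<bar>f i s\<bar> \<le> A"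
    using holder_family_bounded[OF Suc.prems(1)] by metis
  obtain A' where A': "\<And>i s. i \<in> P \<Longrightarrow> s \<in> S \<Longrightarrow> \<bar>g i s\<bar> \<le> A'"
    using holder_family_bounded[OF Suc.prems(2)] by metis
  show ?case
  proof (rule holder_family_SucI[where C = "A + A'"])
    show "\<bar>f i s + g i s\<bar> \<le> A + A'" if "i \<in> P" "s \<in> S" for i s
      using A[OF that] A'[OF that] by linarith
    show "((\<lambda>s. f i s + g i s) has_real_derivative f' i s + g' i s) (at s)"
      if "i \<in> P" "s \<in> S" for i s
      by (intro DERIV_add f' g' that)
    show "H n (\<lambda>i s. f' i s + g' i s)" using Suc.IH f' g' by blast
  qed
qed

lemma bounded_mult:
  assumes "H n f" "H m g"
  obtains C where "\<And>i s. i \<in> P \<Longrightarrow> s \<in> S \<Longrightarrow> \<bar>f i s * g i s\<bar> \<le> C"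
proof -
  obtain A where A: "A > 0" "\<And>i s. i \<in> P \<Longrightarrow> s \<in> S \<Longrightarrow> \<bar>f i s\<bar> \<le> A"
    using holder_family_bounded[OF assms(1)] by metis
  obtain B where B: "B > 0" "\<And>i s. i \<in> P \<Longrightarrow> s \<in> S \<Longrightarrow> \<bar>g i s\<bar> \<le> B"
    using holder_family_bounded[OF assms(2)] by metis
  have "\<bar>f i s * g i s\<bar> \<le> A * B" if "i \<in> P" "s \<in> S" for i s
    unfolding abs_mult using that A B by (intro mult_mono) auto
  then show ?thesis using that by blast
qed

lemma mult:
  assumes "H n f" "H n g"
  shows "H n (\<lambda>i s. f i s * g i s)"
  using assms
proof (induction n arbitrary: f g)
  case 0
  obtain A B where A: "A > 0" "B > 0" "\<And>i s. i \<in> P \<Longrightarrow> s \<in> S \<Longrightarrow> \<bar>f i s\<bar> \<le> A"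
    "\<And>i s t. i \<in> P \<Longrightarrow> s \<in> S \<Longrightarrow> t \<in> S \<Longrightarrow> \<bar>f i s - f i t\<bar> \<le> B * \<bar>s - t\<bar> powr \<beta>"
    using holder_family_0E[OF 0(1)] by metis
  obtain A' B' where A': "A' > 0" "B' > 0" "\<And>i s. i \<in> P \<Longrightarrow> s \<in> S \<Longrightarrow> \<bar>g i s\<bar> \<le> A'"
    "\<And>i s t. i \<in> P \<Longrightarrow> s \<in> S \<Longrightarrow> t \<in> S \<Longrightarrow> \<bar>g i s - g i t\<bar> \<le> B' * \<bar>s - t\<bar> powr \<beta>"
    using holder_family_0E[OF 0(2)] by metis
  obtain C where C: "\<And>i s. i \<in> P \<Longrightarrow> s \<in> S \<Longrightarrow> \<bar>f i s * g i s\<bar> \<le> C"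
    using bounded_mult[OF 0] by blast
  show ?case
  proof (rule holder_family_0I[OF C, where B = "A * B' + B * A'"])
    fix i s t assume st: "i \<in> P" "s \<in> S" "t \<in> S"
    have "\<bar>f i s * g i s - f i t * g i t\<bar> = \<bar>f i s * (g i s - g i t) + (f i s - f i t) * g i t\<bar>"
      by (simp add: algebra_simps)
    also have "\<dots> \<le> \<bar>f i s\<bar> * \<bar>g i s - g i t\<bar> + \<bar>f i s - f i t\<bar> * \<bar>g i t\<bar>"
      by (metis abs_mult abs_triangle_ineq)
    also have "\<dots> \<le> A * (B' * \<bar>s - t\<bar> powr \<beta>) + (B * \<bar>s - t\<bar> powr \<beta>) * A'"
      using st A A' by (intro add_mono mult_mono) auto
    finally show "\<bar>f i s * g i s - f i t * g i t\<bar> \<le> (A * B' + B * A') * \<bar>s - t\<bar> powr \<beta>"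
      by (simp add: algebra_simps)
  qed
next
  case (Suc n)
  obtain f' where f': "\<And>i s. i \<in> P \<Longrightarrow> s \<in> S \<Longrightarrow> (f i has_real_derivative f' i s) (at s)" "H n f'"
    using holder_family_SucE[OF Suc.prems(1)] by metis
  obtain g' where g': "\<And>i s. i \<in> P \<Longrightarrow> s \<in> S \<Longrightarrow> (g i has_real_derivative g' i s) (at s)" "H n g'"
    using holder_family_SucE[OF Suc.prems(2)] by metis
  obtain C where C: "\<And>i s. i \<in> P \<Longrightarrow> s \<in> S \<Longrightarrow> \<bar>f i s * g i s\<bar> \<le> C"
    using bounded_mult[OF Suc.prems] by blast
  have fg: "H n f" "H n g" using mono Suc.prems le_SucI by blast+
  show ?case
  proof (rule holder_family_SucI[OF C])
    show "((\<lambda>s. f i s * g i s) has_real_derivative f i s * g' i s + f' i s * g i s) (at s)"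
      if "i \<in> P" "s \<in> S" for i s
      using DERIV_mult[OF f'(1)[OF that] g'(1)[OF that]] by (simp add: add.commute mult.commute)
    show "H n (\<lambda>i s. f i s * g' i s + f' i s * g i s)"
      using Suc.IH f' g' fg by (intro add) blast+
  qed
qed

text \<open>The derivative of \<open>1 / f\<close> is \<open>- f' * (1 / f) * (1 / f)\<close>, a
  product of families of one order less, one of them provided by the induction hypothesis. The
  common lower bound \<open>c\<close> makes the estimates uniform.\<close>

lemma inverse:
  assumes "H n f" "c > 0" "\<And>i s. i \<in> P \<Longrightarrow> s \<in> S \<Longrightarrow> f i s \<ge> c"
  shows "H n (\<lambda>i s. inverse (f i s))"
  using assms(1)
proof (induction n)
  case 0
  have bd: "\<bar>inverse (f i s)\<bar> \<le> inverse c" if "i \<in> P" "s \<in> S" for i s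
    using assms(3)[OF that] assms(2) by (simp add: le_imp_inverse_le)
  obtain B where B: "B > 0"
    "\<And>i s t. i \<in> P \<Longrightarrow> s \<in> S \<Longrightarrow> t \<in> S \<Longrightarrow> \<bar>f i s - f i t\<bar> \<le> B * \<bar>s - t\<bar> powr \<beta>"
    using holder_family_0E[OF 0] by metis
  show ?case
  proof (rule holder_family_0I[OF bd, where B = "inverse c * B * inverse c"])
    fix i s t assume st: "i \<in> P" "s \<in> S" "t \<in> S"
    have "f i s \<noteq> 0" "f i t \<noteq> 0" using assms(2,3) st by force+
    then have "\<bar>inverse (f i s) - inverse (f i t)\<bar> = \<bar>inverse (f i s)\<bar> * \<bar>f i s - f i t\<bar> * \<bar>inverse (f i t)\<bar>"
      by (simp add: inverse_diff_inverse abs_mult)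
    also have "\<dots> \<le> inverse c * (B * \<bar>s - t\<bar> powr \<beta>) * inverse c"
      using B assms(2) by (intro mult_mono bd st B) auto
    finally show "\<bar>inverse (f i s) - inverse (f i t)\<bar> \<le> inverse c * B * inverse c * \<bar>s - t\<bar> powr \<beta>"
      by (simp add: mult_ac)
  qed
next
  case (Suc n)
  obtain f' where f': "\<And>i s. i \<in> P \<Longrightarrow> s \<in> S \<Longrightarrow> (f i has_real_derivative f' i s) (at s)" "H n f'"
    using holder_family_SucE[OF Suc.prems] by metis
  have IH: "H n (\<lambda>i s. inverse (f i s))" using Suc mono le_SucI by blast
  obtain C where C: "\<And>i s. i \<in> P \<Longrightarrow> s \<in> S \<Longrightarrow> \<bar>inverse (f i s)\<bar> \<le> C"
    using holder_family_bounded[OF IH] by metis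
  show ?case
  proof (rule holder_family_SucI[OF C])
    show "((\<lambda>s. inverse (f i s)) has_real_derivative
        - 1 * (f' i s * (inverse (f i s) * inverse (f i s)))) (at s)" if "i \<in> P" "s \<in> S" for i s
    proof -
      have "f i s \<noteq> 0" using assms(2,3) that by force
      from DERIV_inverse_fun[OF f'(1)[OF that] this] show ?thesis
        by (simp add: power2_eq_square mult_ac)
    qed
    show "H n (\<lambda>i s. - 1 * (f' i s * (inverse (f i s) * inverse (f i s))))"
      by (intro mult f' IH const[where C = 1]) simp
  qed
qed

end

text \<open>The derivative of \<open>g o T\<close> is \<open>(g' / X') o T\<close>, again a
  composition with \<open>T\<close>. Hence an induction over \<open>n\<close> with arbitrary
  \<open>g\<close> never iterates derivatives of \<open>T\<close>. At order 0 it suffices that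
  \<open>T\<close> is Lipschitz with constant \<open>1 / c\<close>. The bound
  \<open>n \<le> Suc N\<close> lets the composition keep the full order of \<open>X\<close>.\<close>

lemma holder_family_compose_inverse:
  assumes J: "holder_domain \<beta> J" and S: "holder_domain \<beta> S"
    and X: "\<And>i t. i \<in> P \<Longrightarrow> t \<in> J \<Longrightarrow> (X i has_real_derivative X' i t) (at t)"
    and c: "c > 0" "\<And>i t. i \<in> P \<Longrightarrow> t \<in> J \<Longrightarrow> X' i t \<ge> c"
    and T: "\<And>i s. i \<in> P \<Longrightarrow> s \<in> S \<Longrightarrow> T i s \<in> J \<and> X i (T i s) = s"
    and N: "holder_family P \<beta> J N X'" and n: "n \<le> Suc N"
    and g: "holder_family P \<beta> J n g"
  shows "holder_family P \<beta> S n (\<lambda>i s. g i (T i s))"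
proof -
  interpret J: holder_domain P \<beta> J by (rule J)
  interpret S: holder_domain P \<beta> S by (rule S)
  have lip: "\<bar>T i s - T i t\<bar> \<le> inverse c * \<bar>s - t\<bar>" if "i \<in> P" "s \<in> S" "t \<in> S" for i s t
  proof -
    have main: "c * (v - u) \<le> X i v - X i u" if uv: "u \<in> J" "v \<in> J" "u < v" for u v
    proof -
      have sub: "w \<in> J" if "u \<le> w" "w \<le> v" for w
        using mem_is_interval_1_I[OF _ uv(1,2) that] J.S(2) by (simp add: is_interval_convex_1)
      then have "\<And>w. u \<le> w \<Longrightarrow> w \<le> v \<Longrightarrow> (X i has_real_derivative X' i w) (at w)"
        using X \<open>i \<in> P\<close> by simp
      then obtain z where "u < z" "z < v" "X i v - X i u = (v - u) * X' i z"
        using MVT2[OF uv(3), of "X i" "X' i"] by metis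
      moreover have "c * (v - u) \<le> X' i z * (v - u)"
        using c(2)[OF \<open>i \<in> P\<close> sub[of z]] uv(3) \<open>u < z\<close> \<open>z < v\<close> by (intro mult_right_mono) auto
      ultimately show ?thesis by (simp add: mult.commute)
    qed
    have m: "T i s \<in> J" "T i t \<in> J" "X i (T i s) = s" "X i (T i t) = t" using T that by blast+
    have "c * \<bar>T i s - T i t\<bar> \<le> \<bar>s - t\<bar>"
    proof (cases "T i s" "T i t" rule: linorder_cases)
      case less
      then show ?thesis using main[OF m(1,2) less] unfolding m by simp
    next
      case greater
      then show ?thesis using main[OF m(2,1) greater] unfolding m by simp
    qed simp
    then show ?thesis using c(1) by (simp add: field_simps)
  qed
  \<comment> \<open>\<open>T\<close> is given only as some right inverse of \<open>X\<close>; its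
    continuity, a premise of the inverse function rule, comes from the expansion estimate
    \<open>lip\<close>.\<close>
  have cont: "isCont (T i) s" if "i \<in> P" "s \<in> S" for i s
  proof -
    have "(inverse c)-lipschitz_on S (T i)"
      using lip[OF that(1)] c(1) by (intro lipschitz_onI) (auto simp: dist_real_def)
    then show ?thesis
      using lipschitz_on_continuous_on S.S(1) that(2) continuous_on_eq_continuous_at by blast
  qed
  have derT: "(T i has_real_derivative inverse (X' i (T i s))) (at s)" if "i \<in> P" "s \<in> S" for i s
  proof -
    obtain e where e: "e > 0" "ball s e \<subseteq> S" using S.S(1) \<open>s \<in> S\<close> openE by blast
    show ?thesis
    proof (rule DERIV_inverse_function[where f = "X i" and a = "s - e" and b = "s + e"])
      show "X i (T i y) = y" if "s - e < y" "y < s + e" for y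
      proof -
        have "y \<in> ball s e" using that by (auto simp: dist_real_def)
        then show ?thesis using T[OF \<open>i \<in> P\<close>] e(2) by blast
      qed
      show "(X i has_real_derivative X' i (T i s)) (at (T i s))"
        using X[OF \<open>i \<in> P\<close>] T[OF that] by blast
      show "X' i (T i s) \<noteq> 0" using c(1) c(2)[OF \<open>i \<in> P\<close>, of "T i s"] T[OF that] by linarith
      show "isCont (T i) s" by (rule cont[OF that])
    qed (use e(1) in auto)
  qed
  show ?thesis using n g
  proof (induction n arbitrary: g)
    case (0 g)
    obtain A B where A: "A > 0" "B > 0" "\<And>i t. i \<in> P \<Longrightarrow> t \<in> J \<Longrightarrow> \<bar>g i t\<bar> \<le> A"
      and B: "\<And>i s t. i \<in> P \<Longrightarrow> s \<in> J \<Longrightarrow> t \<in> J \<Longrightarrow> \<bar>g i s - g i t\<bar> \<le> B * \<bar>s - t\<bar> powr \<beta>"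
      by (rule holder_family_0E[OF 0(2)]) (rule that)
    show ?case
    proof (rule holder_family_0I[where A = A and B = "B * inverse c powr \<beta>"])
      show "\<bar>g i (T i s)\<bar> \<le> A" if "i \<in> P" "s \<in> S" for i s
        using A(3)[OF that(1)] T[OF that] by blast
      fix i s t assume st: "i \<in> P" "s \<in> S" "t \<in> S"
      have "\<bar>g i (T i s) - g i (T i t)\<bar> \<le> B * \<bar>T i s - T i t\<bar> powr \<beta>"
        using B[OF st(1)] T[OF st(1,2)] T[OF st(1,3)] by blast
      also have "\<dots> \<le> B * (inverse c * \<bar>s - t\<bar>) powr \<beta>"
        using lip[OF st] S.\<beta> A(2) by (intro mult_left_mono powr_mono2) auto
      also have "\<dots> = B * inverse c powr \<beta> * \<bar>s - t\<bar> powr \<beta>"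
        using c(1) by (simp add: powr_mult)
      finally show "\<bar>g i (T i s) - g i (T i t)\<bar> \<le> B * inverse c powr \<beta> * \<bar>s - t\<bar> powr \<beta>" .
    qed
  next
    case (Suc n g)
    obtain g' where g': "\<And>i t. i \<in> P \<Longrightarrow> t \<in> J \<Longrightarrow> (g i has_real_derivative g' i t) (at t)"
      "holder_family P \<beta> J n g'"
      by (rule holder_family_SucE[OF Suc.prems(2)]) (rule that)
    obtain A where A: "A > 0" "\<And>i t. i \<in> P \<Longrightarrow> t \<in> J \<Longrightarrow> \<bar>g i t\<bar> \<le> A"
      by (rule holder_family_bounded[OF Suc.prems(2)]) (rule that)
    have nN: "n \<le> N" using Suc.prems(1) by simp
    have "holder_family P \<beta> J n (\<lambda>i t. inverse (X' i t))"
      by (rule J.inverse[OF J.mono[OF N nN] c])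
    then have "holder_family P \<beta> J n (\<lambda>i t. g' i t * inverse (X' i t))"
      by (rule J.mult[OF g'(2)])
    then have 1: "holder_family P \<beta> S n (\<lambda>i s. g' i (T i s) * inverse (X' i (T i s)))"
      using Suc.IH nN by simp
    show ?case
    proof (rule holder_family_SucI[OF _ _ 1])
      show "\<bar>g i (T i s)\<bar> \<le> A" if "i \<in> P" "s \<in> S" for i s
        using A(2)[OF that(1)] T[OF that] by blast
      show "((\<lambda>s. g i (T i s)) has_real_derivative g' i (T i s) * inverse (X' i (T i s))) (at s)"
        if "i \<in> P" "s \<in> S" for i s
        using DERIV_chain2[OF g'(1)[OF that(1)] derT[OF that]] T[OF that] by blast
    qed
  qed
qed

text \<open>This is the passage from the recursive notion to the iterated \<open>deriv\<close> in
  the norm, with a single constant for all orders.\<close>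

lemma holder_family_iterated_deriv:
  assumes "open S" "holder_family P \<beta> S n f"
  obtains C where "C > 0"
    "\<And>i j s. i \<in> P \<Longrightarrow> j < n \<Longrightarrow> s \<in> S \<Longrightarrow> (deriv ^^ j) (f i) differentiable (at s)"
    "\<And>i j s. i \<in> P \<Longrightarrow> j \<le> n \<Longrightarrow> s \<in> S \<Longrightarrow> \<bar>(deriv ^^ j) (f i) s\<bar> \<le> C"
    "\<And>i s t. i \<in> P \<Longrightarrow> s \<in> S \<Longrightarrow> t \<in> S \<Longrightarrow>
      \<bar>(deriv ^^ n) (f i) s - (deriv ^^ n) (f i) t\<bar> \<le> C * \<bar>s - t\<bar> powr \<beta>"
  using assms(2)
proof (induction n arbitrary: f thesis)
  case (0 f thesis)
  obtain A B where A: "A > 0" "B > 0" "\<And>i s. i \<in> P \<Longrightarrow> s \<in> S \<Longrightarrow> \<bar>f i s\<bar> \<le> A"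
    and B: "\<And>i s t. i \<in> P \<Longrightarrow> s \<in> S \<Longrightarrow> t \<in> S \<Longrightarrow> \<bar>f i s - f i t\<bar> \<le> B * \<bar>s - t\<bar> powr \<beta>"
    by (rule holder_family_0E[OF 0(2)]) (rule that)
  have *: "B * r powr \<beta> \<le> (A + B) * r powr \<beta>" for r
    using A by (intro mult_right_mono) auto
  show ?case
  proof (rule 0(1)[of "A + B"])
    show "\<bar>(deriv ^^ j) (f i) s\<bar> \<le> A + B" if "i \<in> P" "j \<le> 0" "s \<in> S" for i j s
      using A(2) A(3)[OF that(1,3)] that(2) by simp
    show "\<bar>(deriv ^^ 0) (f i) s - (deriv ^^ 0) (f i) t\<bar> \<le> (A + B) * \<bar>s - t\<bar> powr \<beta>"
      if "i \<in> P" "s \<in> S" "t \<in> S" for i s t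
      using order_trans[OF B[OF that] *] by simp
  qed (use A in auto)
next
  case (Suc n f thesis)
  obtain A where A: "A > 0" "\<And>i s. i \<in> P \<Longrightarrow> s \<in> S \<Longrightarrow> \<bar>f i s\<bar> \<le> A"
    by (rule holder_family_bounded[OF Suc.prems(2)]) (rule that)
  obtain f' where f': "\<And>i s. i \<in> P \<Longrightarrow> s \<in> S \<Longrightarrow> (f i has_real_derivative f' i s) (at s)"
      "holder_family P \<beta> S n f'"
    by (rule holder_family_SucE[OF Suc.prems(2)]) (rule that)
  obtain C where C: "C > 0" "\<And>i j s. i \<in> P \<Longrightarrow> j < n \<Longrightarrow> s \<in> S \<Longrightarrow> (deriv ^^ j) (f' i) differentiable (at s)"
    "\<And>i j s. i \<in> P \<Longrightarrow> j \<le> n \<Longrightarrow> s \<in> S \<Longrightarrow> \<bar>(deriv ^^ j) (f' i) s\<bar> \<le> C"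
    "\<And>i s t. i \<in> P \<Longrightarrow> s \<in> S \<Longrightarrow> t \<in> S \<Longrightarrow>
      \<bar>(deriv ^^ n) (f' i) s - (deriv ^^ n) (f' i) t\<bar> \<le> C * \<bar>s - t\<bar> powr \<beta>"
    by (rule Suc.IH[OF _ f'(2)]) (rule that)
  \<comment> \<open>Peeling off the innermost \<open>deriv\<close> matches the recursion of
    \<open>holder_family\<close>, which differentiates first.\<close>
  have eq: "(deriv ^^ Suc j) (f i) s = (deriv ^^ j) (f' i) s" if "i \<in> P" "s \<in> S" for i j s
    unfolding funpow_Suc_right comp_def
    by (rule deriv_iterate_cong[OF assms(1) _ that(2)]) (use f'(1) that(1) DERIV_imp_deriv in blast)
  define D where "D = A + C"
  have D: "A \<le> D" "C \<le> D" "D > 0" using A(1) C(1) by (auto simp: D_def)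
  have 1: "(deriv ^^ j) (f i) differentiable (at s)" if "i \<in> P" "j < Suc n" "s \<in> S" for i j s
  proof (cases j)
    case 0
    then show ?thesis using f'(1)[OF that(1,3)] by (auto simp: real_differentiable_def)
  next
    case (Suc m)
    have "(deriv ^^ m) (f' i) differentiable (at s)" using C(2) that Suc by auto
    then show ?thesis unfolding Suc
      using eq[OF that(1)] has_derivative_transform_within_open[OF _ assms(1) that(3)]
      unfolding differentiable_def by metis
  qed
  have 2: "\<bar>(deriv ^^ j) (f i) s\<bar> \<le> D" if "i \<in> P" "j \<le> Suc n" "s \<in> S" for i j s
  proof (cases j)
    case 0
    then show ?thesis using order_trans[OF A(2)[OF that(1,3)] D(1)] by simp
  next
    case (Suc m)
    have "\<bar>(deriv ^^ m) (f' i) s\<bar> \<le> D" using C(3)[of i m s] D(2) that Suc by linarith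
    then show ?thesis unfolding Suc using eq[OF that(1,3)] by simp
  qed
  have 3: "\<bar>(deriv ^^ Suc n) (f i) s - (deriv ^^ Suc n) (f i) t\<bar> \<le> D * \<bar>s - t\<bar> powr \<beta>"
    if "i \<in> P" "s \<in> S" "t \<in> S" for i s t
    unfolding eq[OF that(1,2)] eq[OF that(1,3)]
    by (rule order_trans[OF C(4)[OF that]]) (use D in \<open>auto intro: mult_right_mono\<close>)
  show ?case by (rule Suc.prems(1)[OF D(3) 1 2 3])
qed

lemma holder_family_Ck_holder:
  assumes "open S" "0 < \<beta>" "holder_family P \<beta> S n f"
  shows "\<exists>M>0. \<forall>i\<in>P. Ck_holder_on n \<beta> S (f i) \<and> Ck_holder_norm n \<beta> S (f i) \<le> ennreal M"
proof -
  obtain C where C: "C > 0" "\<And>i j s. i \<in> P \<Longrightarrow> j < n \<Longrightarrow> s \<in> S \<Longrightarrow> (deriv ^^ j) (f i) differentiable (at s)"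
    "\<And>i j s. i \<in> P \<Longrightarrow> j \<le> n \<Longrightarrow> s \<in> S \<Longrightarrow> \<bar>(deriv ^^ j) (f i) s\<bar> \<le> C"
    "\<And>i s t. i \<in> P \<Longrightarrow> s \<in> S \<Longrightarrow> t \<in> S \<Longrightarrow>
      \<bar>(deriv ^^ n) (f i) s - (deriv ^^ n) (f i) t\<bar> \<le> C * \<bar>s - t\<bar> powr \<beta>"
    by (rule holder_family_iterated_deriv[OF assms(1,3)]) (rule that)
  \<comment> \<open>There are \<open>n + 1\<close> suprema, for the orders 0 to \<open>n\<close>,
    and one seminorm, each at most \<open>C\<close>.\<close>
  define M where "M = real (n + 1) * C + C"
  have norm: "Ck_holder_norm n \<beta> S (f i) \<le> ennreal M" if "i \<in> P" for i
  proof -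
    have "(\<Sum>j\<le>n. SUP s\<in>S. ennreal \<bar>(deriv ^^ j) (f i) s\<bar>) \<le> (\<Sum>j\<le>n. ennreal C)"
      by (intro sum_mono SUP_least ennreal_leI) (use C(3) that in auto)
    also have "\<dots> = ennreal (real (n + 1) * C)"
      using C(1) by (simp add: ennreal_mult ennreal_of_nat_eq_real_of_nat algebra_simps)
    finally have 1: "(\<Sum>j\<le>n. SUP s\<in>S. ennreal \<bar>(deriv ^^ j) (f i) s\<bar>) \<le> ennreal (real (n + 1) * C)" .
    have 2: "(SUP s\<in>S. SUP t\<in>S - {s}.
        ennreal (\<bar>(deriv ^^ n) (f i) s - (deriv ^^ n) (f i) t\<bar> / \<bar>s - t\<bar> powr \<beta>)) \<le> ennreal C"
      by (intro SUP_least ennreal_leI) (use C(4) that in \<open>auto simp: divide_le_eq\<close>)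
    have "ennreal M = ennreal (real (n + 1) * C) + ennreal C"
      unfolding M_def using C(1) by (intro ennreal_plus) auto
    then show ?thesis unfolding Ck_holder_norm_def using add_mono[OF 1 2] by simp
  qed
  have "continuous_on S ((deriv ^^ n) (f i))" if "i \<in> P" for i
    unfolding continuous_on
  proof
    fix s assume s: "s \<in> S"
    have "((\<lambda>t. C * \<bar>t - s\<bar> powr \<beta>) \<longlongrightarrow> C * \<bar>s - s\<bar> powr \<beta>) (at s within S)"
      using assms(2) by (intro tendsto_intros) auto
    then have lim: "((\<lambda>t. C * \<bar>t - s\<bar> powr \<beta>) \<longlongrightarrow> 0) (at s within S)" by simp
    have "((\<lambda>t. (deriv ^^ n) (f i) t - (deriv ^^ n) (f i) s) \<longlongrightarrow> 0) (at s within S)"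
      by (rule Lim_null_comparison[OF _ lim])
        (use C(4)[OF that _ s] in \<open>auto simp: eventually_at_filter\<close>)
    then show "((deriv ^^ n) (f i) \<longlongrightarrow> (deriv ^^ n) (f i) s) (at s within S)"
      using LIM_zero_cancel by blast
  qed
  moreover have "Ck_holder_norm n \<beta> S (f i) < \<infinity>" if "i \<in> P" for i
    using le_less_trans[OF norm[OF that] ennreal_less_top] by simp
  moreover have "M > 0" using C(1) by (simp add: M_def add_nonneg_pos)
  ultimately show ?thesis using norm C(2)
    unfolding Ck_holder_on_def by blast
qed

subsection \<open>Rapid oscillations\<close>

text \<open>The derivatives of a rapidly oscillating family lose one factor \<open>d i\<close> (the wavelength) each.\<close>

primrec oscillating :: "'i set \<Rightarrow> ('i \<Rightarrow> real) \<Rightarrow> nat \<Rightarrow> nat \<Rightarrow> ('i \<Rightarrow> real \<Rightarrow> real) \<Rightarrow> bool" where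
  "oscillating P d 0 m f \<longleftrightarrow> (\<exists>C>0. \<forall>i\<in>P. \<forall>s. \<bar>f i s\<bar> \<le> C / d i ^ m)"
| "oscillating P d (Suc n) m f \<longleftrightarrow> (\<exists>C>0. \<forall>i\<in>P. \<forall>s. \<bar>f i s\<bar> \<le> C / d i ^ m) \<and>
     (\<exists>f'. (\<forall>i\<in>P. \<forall>s. (f i has_real_derivative f' i s) (at s)) \<and> oscillating P d n (Suc m) f')"

lemma oscillating_bounded:
  assumes "oscillating P d n m f"
  obtains C where "C > 0" "\<And>i s. i \<in> P \<Longrightarrow> \<bar>f i s\<bar> \<le> C / d i ^ m"
  using assms by (cases n) auto

lemma oscillating_0I:
  assumes "C > 0" "\<And>i s. i \<in> P \<Longrightarrow> \<bar>f i s\<bar> \<le> C / d i ^ m"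
  shows "oscillating P d 0 m f"
  unfolding oscillating.simps using assms by blast

lemma oscillating_SucI:
  assumes "C > 0" "\<And>i s. i \<in> P \<Longrightarrow> \<bar>f i s\<bar> \<le> C / d i ^ m"
    and "\<And>i s. i \<in> P \<Longrightarrow> (f i has_real_derivative f' i s) (at s)"
    and "oscillating P d n (Suc m) f'"
  shows "oscillating P d (Suc n) m f"
  unfolding oscillating.simps using assms by blast

lemma oscillating_SucE:
  assumes "oscillating P d (Suc n) m f"
  obtains f' where "\<And>i s. i \<in> P \<Longrightarrow> (f i has_real_derivative f' i s) (at s)"
    "oscillating P d n (Suc m) f'"
  using assms unfolding oscillating.simps by blast

lemma oscillating_SucD: "oscillating P d (Suc n) m f \<Longrightarrow> oscillating P d n m f"
proof (induction n arbitrary: m f)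
  case (0 m f)
  obtain C where C: "C > 0" "\<And>i s. i \<in> P \<Longrightarrow> \<bar>f i s\<bar> \<le> C / d i ^ m"
    by (rule oscillating_bounded[OF 0]) (rule that)
  show ?case by (rule oscillating_0I[OF C])
next
  case (Suc n m f)
  obtain C where C: "C > 0" "\<And>i s. i \<in> P \<Longrightarrow> \<bar>f i s\<bar> \<le> C / d i ^ m"
    by (rule oscillating_bounded[OF Suc.prems]) (rule that)
  obtain f' where f': "\<And>i s. i \<in> P \<Longrightarrow> (f i has_real_derivative f' i s) (at s)"
    "oscillating P d (Suc n) (Suc m) f'"
    by (rule oscillating_SucE[OF Suc.prems]) (rule that)
  show ?case by (rule oscillating_SucI[OF C f'(1) Suc.IH[OF f'(2)]])
qed

lemma oscillating_add:
  assumes "oscillating P d n m f" "oscillating P d n m g"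
  shows "oscillating P d n m (\<lambda>i s. f i s + g i s)"
  using assms
proof (induction n arbitrary: m f g)
  case (0 m f g)
  obtain A where A: "A > 0" "\<And>i s. i \<in> P \<Longrightarrow> \<bar>f i s\<bar> \<le> A / d i ^ m"
    using oscillating_bounded[OF 0(1)] by metis
  obtain B where B: "B > 0" "\<And>i s. i \<in> P \<Longrightarrow> \<bar>g i s\<bar> \<le> B / d i ^ m"
    using oscillating_bounded[OF 0(2)] by metis
  have bd: "\<bar>f i s + g i s\<bar> \<le> (A + B) / d i ^ m" if "i \<in> P" for i s
    unfolding add_divide_distrib using A(2)[OF that, of s] B(2)[OF that, of s] by linarith
  show ?case by (rule oscillating_0I[OF _ bd]) (use A B in auto)
next
  case (Suc n m f g)
  obtain A where A: "A > 0" "\<And>i s. i \<in> P \<Longrightarrow> \<bar>f i s\<bar> \<le> A / d i ^ m"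
    using oscillating_bounded[OF Suc.prems(1)] by metis
  obtain B where B: "B > 0" "\<And>i s. i \<in> P \<Longrightarrow> \<bar>g i s\<bar> \<le> B / d i ^ m"
    using oscillating_bounded[OF Suc.prems(2)] by metis
  have bd: "\<bar>f i s + g i s\<bar> \<le> (A + B) / d i ^ m" if "i \<in> P" for i s
    unfolding add_divide_distrib using A(2)[OF that, of s] B(2)[OF that, of s] by linarith
  obtain f' where f': "\<And>i s. i \<in> P \<Longrightarrow> (f i has_real_derivative f' i s) (at s)"
    "oscillating P d n (Suc m) f'" using oscillating_SucE[OF Suc.prems(1)] by metis
  obtain g' where g': "\<And>i s. i \<in> P \<Longrightarrow> (g i has_real_derivative g' i s) (at s)"
    "oscillating P d n (Suc m) g'" using oscillating_SucE[OF Suc.prems(2)] by metis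
  show ?case
    by (rule oscillating_SucI[OF _ bd DERIV_add[OF f'(1) g'(1)] Suc.IH[OF f'(2) g'(2)]])
      (use A B in auto)
qed

lemma oscillating_mult:
  assumes "oscillating P d n m f" "oscillating P d n l g"
  shows "oscillating P d n (m + l) (\<lambda>i s. f i s * g i s)"
  using assms
proof (induction n arbitrary: m l f g)
  case (0 m l f g)
  obtain A where A: "A > 0" "\<And>i s. i \<in> P \<Longrightarrow> \<bar>f i s\<bar> \<le> A / d i ^ m"
    using oscillating_bounded[OF 0(1)] by metis
  obtain B where B: "B > 0" "\<And>i s. i \<in> P \<Longrightarrow> \<bar>g i s\<bar> \<le> B / d i ^ l"
    using oscillating_bounded[OF 0(2)] by metis
  have bd: "\<bar>f i s * g i s\<bar> \<le> (A * B) / d i ^ (m + l)" if "i \<in> P" for i s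
    unfolding abs_mult power_add times_divide_times_eq[symmetric]
    using A(2)[OF that, of s] B(2)[OF that, of s]
    by (intro mult_mono) (auto intro: order_trans[OF abs_ge_zero])
  show ?case by (rule oscillating_0I[OF _ bd]) (use A B in auto)
next
  case (Suc n m l f g)
  obtain A where A: "A > 0" "\<And>i s. i \<in> P \<Longrightarrow> \<bar>f i s\<bar> \<le> A / d i ^ m"
    using oscillating_bounded[OF Suc.prems(1)] by metis
  obtain B where B: "B > 0" "\<And>i s. i \<in> P \<Longrightarrow> \<bar>g i s\<bar> \<le> B / d i ^ l"
    using oscillating_bounded[OF Suc.prems(2)] by metis
  have bd: "\<bar>f i s * g i s\<bar> \<le> (A * B) / d i ^ (m + l)" if "i \<in> P" for i s
    unfolding abs_mult power_add times_divide_times_eq[symmetric]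
    using A(2)[OF that, of s] B(2)[OF that, of s]
    by (intro mult_mono) (auto intro: order_trans[OF abs_ge_zero])
  obtain f' where f': "\<And>i s. i \<in> P \<Longrightarrow> (f i has_real_derivative f' i s) (at s)"
    "oscillating P d n (Suc m) f'" using oscillating_SucE[OF Suc.prems(1)] by metis
  obtain g' where g': "\<And>i s. i \<in> P \<Longrightarrow> (g i has_real_derivative g' i s) (at s)"
    "oscillating P d n (Suc l) g'" using oscillating_SucE[OF Suc.prems(2)] by metis
  have 1: "oscillating P d n (Suc (m + l)) (\<lambda>i s. f i s * g' i s)"
    using Suc.IH[OF oscillating_SucD[OF Suc.prems(1)] g'(2)] by simp
  have 2: "oscillating P d n (Suc (m + l)) (\<lambda>i s. f' i s * g i s)"
    using Suc.IH[OF f'(2) oscillating_SucD[OF Suc.prems(2)]] by simp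
  have D: "((\<lambda>s. f i s * g i s) has_real_derivative f i s * g' i s + f' i s * g i s) (at s)"
    if "i \<in> P" for i s
    using DERIV_mult[OF f'(1)[OF that] g'(1)[OF that], of s] by (simp add: add.commute mult.commute)
  show ?case
    by (rule oscillating_SucI[OF _ bd D oscillating_add[OF 1 2]]) (use A B in auto)
qed

lemma oscillating_uminus:
  assumes "oscillating P d n m f"
  shows "oscillating P d n m (\<lambda>i s. - f i s)"
  using assms
proof (induction n arbitrary: m f)
  case (Suc n m f)
  obtain A where A: "A > 0" "\<And>i s. i \<in> P \<Longrightarrow> \<bar>f i s\<bar> \<le> A / d i ^ m"
    using oscillating_bounded[OF Suc.prems(1)] by metis
  obtain f' where f': "\<And>i s. i \<in> P \<Longrightarrow> (f i has_real_derivative f' i s) (at s)"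
    "oscillating P d n (Suc m) f'" using oscillating_SucE[OF Suc.prems(1)] by metis
  show ?case
    by (rule oscillating_SucI[OF A(1) _ DERIV_minus[OF f'(1)] Suc.IH[OF f'(2)]]) (use A in auto)
qed auto

lemma oscillating_divide:
  assumes "oscillating P d n m f" "\<And>i. i \<in> P \<Longrightarrow> 0 < d i"
  shows "oscillating P d n (Suc m) (\<lambda>i s. f i s / d i)"
  using assms(1)
proof (induction n arbitrary: m f)
  case (0 m f)
  obtain A where A: "A > 0" "\<And>i s. i \<in> P \<Longrightarrow> \<bar>f i s\<bar> \<le> A / d i ^ m"
    by (rule oscillating_bounded[OF 0]) (rule that)
  have bd: "\<bar>f i s / d i\<bar> \<le> A / d i ^ Suc m" if "i \<in> P" for i s
    using A(2)[OF that, of s] assms(2)[OF that] by (simp add: field_simps)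
  show ?case by (rule oscillating_0I[OF A(1)]) (rule bd)
next
  case (Suc n m f)
  obtain A where A: "A > 0" "\<And>i s. i \<in> P \<Longrightarrow> \<bar>f i s\<bar> \<le> A / d i ^ m"
    by (rule oscillating_bounded[OF Suc.prems]) (rule that)
  have bd: "\<bar>f i s / d i\<bar> \<le> A / d i ^ Suc m" if "i \<in> P" for i s
    using A(2)[OF that, of s] assms(2)[OF that] by (simp add: field_simps)
  obtain f' where f': "\<And>i s. i \<in> P \<Longrightarrow> (f i has_real_derivative f' i s) (at s)"
    "oscillating P d n (Suc m) f'"
    by (rule oscillating_SucE[OF Suc.prems]) (rule that)
  show ?case
  proof (rule oscillating_SucI[OF A(1)])
    show "oscillating P d n (Suc (Suc m)) (\<lambda>i s. f' i s / d i)" by (rule Suc.IH[OF f'(2)])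
  qed (rule bd, assumption, rule DERIV_cdivide[OF f'(1)])
qed

text \<open>These functions vary slowly: no derivative exceeds 1, and
  \<open>1 \<le> 1 / d i ^ m\<close> because \<open>d i \<le> 1\<close>. So they qualify for every
  weight \<open>m\<close>, which lets the induction raise \<open>m\<close>.\<close>

lemma oscillating_trig:
  assumes d: "\<And>i. i \<in> P \<Longrightarrow> 0 < d i \<and> d i \<le> 1"
  shows "oscillating P d n m (\<lambda>i s. sin (c i + s)) \<and> oscillating P d n m (\<lambda>i s. cos (c i + s))"
proof -
  have bd: "\<bar>sin (c i + s)\<bar> \<le> 1 / d i ^ m" "\<bar>cos (c i + s)\<bar> \<le> 1 / d i ^ m" if "i \<in> P" for i s m
  proof -
    have "1 \<le> 1 / d i ^ m" using d[OF that] by (simp add: power_le_one)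
    then show "\<bar>sin (c i + s)\<bar> \<le> 1 / d i ^ m" "\<bar>cos (c i + s)\<bar> \<le> 1 / d i ^ m"
      using abs_sin_le_one abs_cos_le_one order_trans by blast+
  qed
  show ?thesis
  proof (induction n arbitrary: m)
    case (0 m)
    have "oscillating P d 0 m (\<lambda>i s. sin (c i + s))"
      by (rule oscillating_0I[OF zero_less_one]) (rule bd)
    moreover have "oscillating P d 0 m (\<lambda>i s. cos (c i + s))"
      by (rule oscillating_0I[OF zero_less_one]) (rule bd)
    ultimately show ?case ..
  next
    case (Suc n m)
    have "oscillating P d (Suc n) m (\<lambda>i s. sin (c i + s))"
    proof (rule oscillating_SucI[OF zero_less_one])
      show "oscillating P d n (Suc m) (\<lambda>i s. cos (c i + s))" using Suc ..
    qed (rule bd, auto intro!: derivative_eq_intros)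
    moreover have "oscillating P d (Suc n) m (\<lambda>i s. cos (c i + s))"
    proof (rule oscillating_SucI[OF zero_less_one])
      show "oscillating P d n (Suc m) (\<lambda>i s. - sin (c i + s))"
        using oscillating_uminus conjunct1[OF Suc] by blast
    qed (rule bd, auto intro!: derivative_eq_intros)
    ultimately show ?case ..
  qed
qed

text \<open>The phase \<open>q\<close> enters only through its derivative, since sine and cosine are
  bounded whatever their argument. Each differentiation produces one factor \<open>q'\<close>, of
  weight 1.\<close>

lemma oscillating_sin_cos:
  assumes q: "\<And>i s. i \<in> P \<Longrightarrow> (q i has_real_derivative q' i s) (at s)"
    and q': "\<And>n. oscillating P d n 1 q'"
  shows "oscillating P d n 0 (\<lambda>i s. sin (q i s)) \<and> oscillating P d n 0 (\<lambda>i s. cos (q i s))"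
proof (induction n)
  case 0
  have "oscillating P d 0 0 (\<lambda>i s. sin (q i s))" "oscillating P d 0 0 (\<lambda>i s. cos (q i s))"
    by (rule oscillating_0I[OF zero_less_one]; simp)+
  then show ?case ..
next
  case (Suc n)
  have 1: "oscillating P d n (Suc 0) (\<lambda>i s. q' i s * cos (q i s))"
    using oscillating_mult[OF q' conjunct2[OF Suc]] by simp
  have "oscillating P d n (Suc 0) (\<lambda>i s. q' i s * sin (q i s))"
    using oscillating_mult[OF q' conjunct1[OF Suc]] by simp
  note 2 = oscillating_uminus[OF this]
  have "oscillating P d (Suc n) 0 (\<lambda>i s. sin (q i s))"
    by (rule oscillating_SucI[OF _ _ _ 1, of 1]) (use q in \<open>auto intro!: derivative_eq_intros\<close>)
  moreover have "oscillating P d (Suc n) 0 (\<lambda>i s. cos (q i s))"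
    by (rule oscillating_SucI[OF _ _ _ 2, of 1]) (use q in \<open>auto intro!: derivative_eq_intros\<close>)
  ultimately show ?case ..
qed

text \<open>Interpolation between the bounds on the \<open>k\<close>-th and the \<open>(k+1)\<close>-st derivative turns the factor
  \<open>d powr (k + \<beta>)\<close> into a uniform bound on the Hoelder seminorm of the \<open>k\<close>-th derivative.\<close>

lemma (in holder_domain) scaled_oscillating:
  assumes d: "\<And>i. i \<in> P \<Longrightarrow> 0 < d i \<and> d i \<le> 1"
    and f: "oscillating P d (Suc n) m f" and k: "m + n = k"
  shows "H n (\<lambda>i s. d i powr (real k + \<beta>) * f i s)"
  using f k
proof (induction n arbitrary: m f)
  case (0 m f)
  obtain A where A: "A > 0" "\<And>i s. i \<in> P \<Longrightarrow> \<bar>f i s\<bar> \<le> A / d i ^ m"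
    using oscillating_bounded[OF 0(1)] by metis
  obtain f' where f': "\<And>i s. i \<in> P \<Longrightarrow> (f i has_real_derivative f' i s) (at s)"
    "oscillating P d 0 (Suc m) f'" using oscillating_SucE[OF 0(1)] by metis
  obtain B where B: "B > 0" "\<And>i s. i \<in> P \<Longrightarrow> \<bar>f' i s\<bar> \<le> B / d i ^ Suc m"
    using oscillating_bounded[OF f'(2)] by metis
  have km: "k = m" using 0 by simp
  have sc: "d i powr (real k + \<beta>) = d i ^ m * d i powr \<beta>" if "i \<in> P" for i
    using d[OF that] by (simp add: powr_add powr_realpow km)
  show ?case
  proof (rule holder_family_0I[where A = A and B = "2 * A + B"])
    fix i s assume i: "i \<in> P"
    have "\<bar>d i powr (real k + \<beta>) * f i s\<bar> \<le> d i ^ m * d i powr \<beta> * (A / d i ^ m)"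
      unfolding abs_mult sc[OF i] using d[OF i] by (intro mult_mono A i) auto
    also have "\<dots> = d i powr \<beta> * A" using d[OF i] by simp
    also have "\<dots> \<le> 1 * A" using d[OF i] \<beta> A by (intro mult_right_mono powr_le1) auto
    finally show "\<bar>d i powr (real k + \<beta>) * f i s\<bar> \<le> A" by simp
  next
    fix i s t assume i: "i \<in> P" "s \<in> S" "t \<in> S"
    \<comment> \<open>Distance in units of the wavelength. For \<open>r \<ge> 1\<close> the sup
      bound on \<open>f\<close> is the better one, for \<open>r < 1\<close> the bound on
      \<open>f'\<close>; both are at most a multiple of \<open>r powr \<beta>\<close>.\<close>
    define r where "r = \<bar>s - t\<bar> / d i"
    have r: "\<bar>s - t\<bar> = d i * r" "r \<ge> 0" using d[OF i(1)] by (auto simp: r_def)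
    have 1: "\<bar>f i s - f i t\<bar> \<le> 2 * A / d i ^ m"
      using A(2)[OF i(1), of s] A(2)[OF i(1), of t] by linarith
    have "\<bar>f i s - f i t\<bar> \<le> B / d i ^ Suc m * \<bar>s - t\<bar>"
      using mean_value_bound[of "f i" "f' i" _ s t] f' B i by blast
    then have 2: "\<bar>f i s - f i t\<bar> \<le> B / d i ^ m * r" using d[OF i(1)] by (simp add: r_def mult.commute)
    have "\<bar>f i s - f i t\<bar> \<le> (2 * A + B) / d i ^ m * r powr \<beta>"
    proof (cases "r \<ge> 1")
      case True
      have "2 * A / d i ^ m * 1 \<le> (2 * A + B) / d i ^ m * r powr \<beta>"
        using A B d[OF i(1)] True \<beta> by (intro mult_mono divide_right_mono ge_one_powr_ge_zero) auto
      then show ?thesis using 1 by simp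
    next
      case False
      have "r powr 1 \<le> r powr \<beta>" using False \<beta> r by (intro powr_mono') auto
      then have "r \<le> r powr \<beta>" using r by simp
      then have "B / d i ^ m * r \<le> (2 * A + B) / d i ^ m * r powr \<beta>"
        using A B d[OF i(1)] r by (intro mult_mono divide_right_mono) auto
      then show ?thesis using 2 by simp
    qed
    then have "d i powr (real k + \<beta>) * \<bar>f i s - f i t\<bar>
        \<le> d i ^ m * d i powr \<beta> * ((2 * A + B) / d i ^ m * r powr \<beta>)"
      unfolding sc[OF i(1)] using d[OF i(1)] by (intro mult_left_mono) auto
    also have "\<dots> = (2 * A + B) * (d i * r) powr \<beta>"
      using d[OF i(1)] r by (simp add: powr_mult)
    finally show "\<bar>d i powr (real k + \<beta>) * f i s - d i powr (real k + \<beta>) * f i t\<bar>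
        \<le> (2 * A + B) * \<bar>s - t\<bar> powr \<beta>"
      unfolding r(1) by (simp add: abs_mult flip: right_diff_distrib)
  qed
next
  case (Suc n m f)
  obtain A where A: "A > 0" "\<And>i s. i \<in> P \<Longrightarrow> \<bar>f i s\<bar> \<le> A / d i ^ m"
    using oscillating_bounded[OF Suc.prems(1)] by metis
  obtain f' where f': "\<And>i s. i \<in> P \<Longrightarrow> (f i has_real_derivative f' i s) (at s)"
    "oscillating P d (Suc n) (Suc m) f'" using oscillating_SucE[OF Suc.prems(1)] by metis
  show ?case
  proof (rule holder_family_SucI[where C = A])
    fix i s assume i: "i \<in> P"
    \<comment> \<open>Below the top order \<open>m < k\<close>, so with \<open>d i \<le> 1\<close>
      the prefactor absorbs the loss \<open>1 / d i ^ m\<close>.\<close>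
    have "d i powr (real k + \<beta>) \<le> d i powr real m"
      using d[OF i] \<beta> Suc.prems by (intro powr_mono') auto
    then have "d i powr (real k + \<beta>) \<le> d i ^ m" using d[OF i] by (simp add: powr_realpow)
    then have "\<bar>d i powr (real k + \<beta>) * f i s\<bar> \<le> d i ^ m * (A / d i ^ m)"
      unfolding abs_mult using d[OF i] by (intro mult_mono A i) auto
    then show "\<bar>d i powr (real k + \<beta>) * f i s\<bar> \<le> A" using d[OF i] by simp
  next
    show "((\<lambda>s. d i powr (real k + \<beta>) * f i s) has_real_derivative d i powr (real k + \<beta>) * f' i s) (at s)"
      if "i \<in> P" for i s
      by (rule DERIV_cmult[OF f'(1)[OF that]])
    show "H n (\<lambda>i s. d i powr (real k + \<beta>) * f' i s)"
      using Suc.IH[OF f'(2)] Suc.prems(2) by simp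
  qed
qed

lemma (in holder_domain) trig:
  "H n (\<lambda>i s. sin (c i + s)) \<and> H n (\<lambda>i s. cos (c i + s))"
proof -
  have bd: "\<bar>sin (c i + s)\<bar> \<le> 1" "\<bar>cos (c i + s)\<bar> \<le> 1" for i s by simp_all
  have mv: "\<bar>sin (c i + s) - sin (c i + t)\<bar> \<le> 1 * \<bar>s - t\<bar> powr \<beta>"
    "\<bar>cos (c i + s) - cos (c i + t)\<bar> \<le> 1 * \<bar>s - t\<bar> powr \<beta>" if "s \<in> S" "t \<in> S" for i s t
  proof -
    have "\<bar>sin (c i + s) - sin (c i + t)\<bar> \<le> 1 * \<bar>s - t\<bar>"
      by (rule mean_value_bound[OF _ bd(2) that]) (auto intro!: derivative_eq_intros)
    then show "\<bar>sin (c i + s) - sin (c i + t)\<bar> \<le> 1 * \<bar>s - t\<bar> powr \<beta>"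
      by (rule lipschitz_holder[OF that]) simp
    have "\<bar>cos (c i + s) - cos (c i + t)\<bar> \<le> 1 * \<bar>s - t\<bar>"
      by (rule mean_value_bound[where f' = "\<lambda>s. - sin (c i + s)", OF _ _ that])
        (auto intro!: derivative_eq_intros)
    then show "\<bar>cos (c i + s) - cos (c i + t)\<bar> \<le> 1 * \<bar>s - t\<bar> powr \<beta>"
      by (rule lipschitz_holder[OF that]) simp
  qed
  show ?thesis
  proof (induction n)
    case 0
    show ?case by (rule conjI; rule holder_family_0I; (rule bd mv)?; assumption?)
  next
    case (Suc n)
    have "H n (\<lambda>i s. - 1 * sin (c i + s))"
      by (rule mult[OF const[where C = 1] conjunct1[OF Suc]]) simp
    then have "H (Suc n) (\<lambda>i s. cos (c i + s))"
      by (rule holder_family_SucI[OF bd(2), rotated]) (auto intro!: derivative_eq_intros)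
    moreover have "H (Suc n) (\<lambda>i s. sin (c i + s))"
      by (rule holder_family_SucI[OF bd(1) _ conjunct2[OF Suc]]) (auto intro!: derivative_eq_intros)
    ultimately show ?case by (simp only:)
  qed
qed

subsection \<open>Sheared discs and their critical value\<close>

definition sheared_disc :: "(real \<Rightarrow> real) \<Rightarrow> (real^2) set" where
  "sheared_disc G = {x. (x $ 1)\<^sup>2 + (x $ 2 - G (x $ 1))\<^sup>2 < 1}"

lemma open_sheared_disc:
  assumes "continuous_on UNIV G"
  shows "open (sheared_disc G)"
proof -
  have "continuous_on UNIV (\<lambda>x :: real^2. G (x $ 1))"
    by (rule continuous_on_compose2[OF assms]) (auto intro: continuous_intros)
  then show ?thesis
    unfolding sheared_disc_def by (intro open_Collect_less continuous_intros)
qed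

lemma bounded_sheared_disc:
  assumes "\<And>u. \<bar>G u\<bar> \<le> c"
  shows "bounded (sheared_disc G)"
proof -
  have "norm x \<le> 2 + c" if "x \<in> sheared_disc G" for x
  proof -
    have "(x $ 1)\<^sup>2 < 1" "(x $ 2 - G (x $ 1))\<^sup>2 < 1"
      using that sum_power2_ge_zero[of "x $ 1" 0] sum_power2_ge_zero[of "x $ 2 - G (x $ 1)" 0]
      by (auto simp: sheared_disc_def intro: le_less_trans[rotated])
    then have "\<bar>x $ 1\<bar> < 1" "\<bar>x $ 2 - G (x $ 1)\<bar> < 1" by (auto simp: abs_square_less_1)
    then have "\<bar>x $ 1\<bar> + \<bar>x $ 2\<bar> \<le> 2 + c" using assms[of "x $ 1"] by linarith
    then show ?thesis using norm_le_l1_cart[of x] by (simp add: sum_2)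
  qed
  then show ?thesis by (auto simp: bounded_iff)
qed

section \<open>Reflections as involutions\<close>

lemma inner_axis1: "x \<bullet> axis 1 1 = (x::real^2) $ 1"
  by (simp add: inner_axis)

lemma reflection_axis1:
  "reflection (axis 1 1) \<mu> (x::real^2) = vector [2 * \<mu> - x $ 1, x $ 2]"
  by (simp add: reflection_def inner_axis1 vec_eq_iff forall_2) (simp add: axis_def)

lemma reflection_involution:
  assumes "norm e = 1"
  shows "reflection e \<mu> (reflection e \<mu> x) = x"
proof -
  have "e \<bullet> e = 1" using assms by (simp add: norm_eq_1)
  then show ?thesis by (simp add: reflection_def inner_diff_left algebra_simps flip: scaleR_add_left)
qed

text \<open>An involution turns images into preimages, so that openness passes to the reflected set
  by continuity.\<close>

lemma reflection_image:
  assumes "norm e = 1"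
  shows "reflection e \<mu> ` A = {x. reflection e \<mu> x \<in> A}"
proof (intro set_eqI iffI)
  show "x \<in> reflection e \<mu> ` A" if "x \<in> {x. reflection e \<mu> x \<in> A}" for x
    using that image_eqI[of x "reflection e \<mu>" "reflection e \<mu> x"] reflection_involution[OF assms]
    by simp
qed (auto simp: reflection_involution[OF assms])

lemma continuous_on_reflection: "continuous_on S (reflection e \<mu>)"
  unfolding reflection_def by (intro continuous_intros)

section \<open>Planar Lebesgue measure through vertical sections\<close>

lemma measurable_vec2:
  "(\<lambda>(s, y). vector [s, y] :: real^2) \<in> borel_measurable (lborel :: (real \<times> real) measure)"
proof -
  have eq: "vector [s, y] = s *\<^sub>R axis 1 1 + y *\<^sub>R (axis 2 1 :: real^2)" for s y
    by (simp add: vec_eq_iff forall_2) (simp add: axis_def)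
  have "continuous_on UNIV (\<lambda>z :: real \<times> real. vector [fst z, snd z] :: real^2)"
    unfolding eq by (intro continuous_intros)
  then show ?thesis
    unfolding case_prod_beta by (simp add: borel_measurable_continuous_onI)
qed

text \<open>Fubini is available for product measures, while the plane here is a space of vectors.
  Both measures agree on boxes, which determine \<open>lborel\<close>.\<close>

lemma lborel_vec2:
  "(lborel :: (real^2) measure) = distr lborel borel (\<lambda>(s, y). vector [s, y])"
proof (rule lborel_eqI)
  note m = measurable_vec2
  fix l u :: "real^2"
  assume lu: "\<And>b. b \<in> Basis \<Longrightarrow> l \<bullet> b \<le> u \<bullet> b"
  have B: "(Basis :: (real^2) set) = {axis 1 1, axis 2 1}"
    by (auto simp: Basis_vec_def UNIV_2)
  have ne: "axis 1 1 \<noteq> (axis 2 1 :: real^2)" by (simp add: axis_eq_axis)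
  have lu': "l $ 1 \<le> u $ 1" "l $ 2 \<le> u $ 2"
    using lu[of "axis 1 1"] lu[of "axis 2 1"] B by (auto simp: inner_axis)
  have "(\<lambda>(s, y). vector [s, y] :: real^2) -` box l u = box (l $ 1, l $ 2) (u $ 1, u $ 2)"
    by (auto simp: mem_box_cart forall_2 mem_box Basis_prod_def)
  then have "emeasure (distr lborel borel (\<lambda>(s, y). vector [s, y])) (box l u)
      = emeasure lborel (box (l $ 1, l $ 2) (u $ 1, u $ 2) :: (real \<times> real) set)"
    using m by (simp add: emeasure_distr)
  also have "\<dots> = ennreal ((u $ 1 - l $ 1) * (u $ 2 - l $ 2))"
    using lu' by (subst emeasure_lborel_box) (auto simp: Basis_prod_def)
  also have "\<dots> = ennreal (\<Prod>b\<in>Basis. (u - l) \<bullet> b)"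
    using ne by (simp add: B inner_axis)
  finally show "emeasure (distr lborel borel (\<lambda>(s, y). vector [s, y])) (box l u)
      = ennreal (\<Prod>b\<in>Basis. (u - l) \<bullet> b)" .
qed simp

text \<open>Cavalieri's principle, with all sections outside \<open>a < s < b\<close>
  discarded.\<close>

lemma emeasure_vec2_ge_sections:
  fixes A :: "(real^2) set"
  assumes "A \<in> sets borel" "a \<le> b" "h \<ge> 0"
    and "\<And>s. a < s \<Longrightarrow> s < b \<Longrightarrow> ennreal h \<le> emeasure lborel {y. vector [s, y] \<in> A}"
  shows "ennreal (h * (b - a)) \<le> emeasure lborel A"
proof -
  note m = measurable_vec2
  define B where "B = {z :: real \<times> real. vector [fst z, snd z] \<in> A}"
  have B: "B \<in> sets (lborel \<Otimes>\<^sub>M lborel)"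
    using measurable_sets[OF m assms(1)] unfolding lborel_prod
    by (simp add: B_def vimage_def case_prod_beta)
  have "emeasure lborel A = emeasure lborel B"
    by (subst lborel_vec2) (use assms(1) m in \<open>simp add: emeasure_distr B_def vimage_def case_prod_beta\<close>)
  also have "\<dots> = emeasure (lborel \<Otimes>\<^sub>M lborel) B" by (simp add: lborel_prod)
  also have "\<dots> = (\<integral>\<^sup>+ s. emeasure lborel (Pair s -` B) \<partial>lborel)"
    by (rule lborel.emeasure_pair_measure_alt[OF B])
  also have "\<dots> \<ge> (\<integral>\<^sup>+ s. ennreal h * indicator {a<..<b} s \<partial>lborel)"
    using assms(4) by (intro nn_integral_mono) (auto simp: indicator_def B_def vimage_def)
  also have "(\<integral>\<^sup>+ s. ennreal h * indicator {a<..<b} s \<partial>lborel) = ennreal (h * (b - a))"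
    using assms(2,3) by (simp add: nn_integral_cmult_indicator ennreal_mult)
  finally show ?thesis .
qed

text \<open>Removing an interval of length \<open>2 * r\<close> costs at most that length, wherever
  its centre lies. This is why the vertical displacement of sections by the shear does no
  harm.\<close>

lemma emeasure_interval_diff_ge:
  fixes c c' r r' :: real
  assumes "0 \<le> r" "r \<le> r'"
  shows "ennreal (2 * (r' - r)) \<le> emeasure lborel ({c' - r'<..<c' + r'} - {c - r<..<c + r})"
proof -
  have "ennreal (2 * r') = emeasure lborel {c' - r'<..<c' + r'}" using assms by simp
  also have "\<dots> \<le> emeasure lborel (({c' - r'<..<c' + r'} - {c - r<..<c + r}) \<union> {c - r<..<c + r})"
    by (intro emeasure_mono) auto
  also have "\<dots> \<le> emeasure lborel ({c' - r'<..<c' + r'} - {c - r<..<c + r}) + emeasure lborel {c - r<..<c + r}"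
    by (intro emeasure_subadditive) auto
  also have "emeasure lborel {c - r<..<c + r} = ennreal (2 * r)" using assms by simp
  finally have "ennreal (2 * r') - ennreal (2 * r) \<le> emeasure lborel ({c' - r'<..<c' + r'} - {c - r<..<c + r})"
    by (simp add: ennreal_minus_le_iff add.commute)
  then show ?thesis using assms by (simp add: ennreal_minus right_diff_distrib)
qed

text \<open>The radicands \<open>a\<close> and \<open>b\<close> differ by \<open>4 * l * t\<close>.
  If \<open>b \<ge> 0\<close>, the two roots add up to at most 2, so they differ by at least
  \<open>2 * l * t\<close>. If \<open>b < 0\<close>, the right line misses the disc and the left
  chord alone suffices: \<open>sqrt a \<ge> a \<ge> t\<close>.\<close>

lemma sqrt_chord_gap:
  fixes l t :: real
  assumes "0 < l" "l \<le> 1" "0 < t" "t \<le> 1/4"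
  shows "l * t \<le> sqrt (max 0 (1 - (l - t)\<^sup>2)) - sqrt (max 0 (1 - (l + t)\<^sup>2))"
proof -
  define a where "a = 1 - (l - t)\<^sup>2"
  define b where "b = 1 - (l + t)\<^sup>2"
  have lt: "0 \<le> l * t" "l * t \<le> t" using assms by (auto simp: mult_left_le_one_le)
  have ab: "a - b = 4 * (l * t)" by (simp add: a_def b_def power2_eq_square algebra_simps)
  have a1: "a \<le> 1" by (simp add: a_def)
  show ?thesis
  proof (cases "b \<ge> 0")
    case True
    have s: "sqrt b \<le> sqrt a" "sqrt a \<le> 1" using True ab lt a1 by auto
    then have "sqrt a + sqrt b \<le> 2" by linarith
    have "4 * (l * t) = (sqrt a - sqrt b) * (sqrt a + sqrt b)"
      using True ab lt by (simp add: algebra_simps)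
    also have "\<dots> \<le> (sqrt a - sqrt b) * 2" using s \<open>sqrt a + sqrt b \<le> 2\<close> by (intro mult_left_mono) auto
    finally show ?thesis using True ab lt by (simp add: a_def[symmetric] b_def[symmetric])
  next
    case False
    have "a = (1 - l + t) * (1 + l - t)" by (simp add: a_def power2_eq_square algebra_simps)
    moreover have "(1 - l + t) * (1 + l - t) \<ge> t * 1"
    proof (cases "l \<ge> t")
      case True then show ?thesis using assms by (intro mult_mono) auto
    next
      case False
      then have "(1 - l + t) * (1 + l - t) \<ge> 1 * (3/4)" using assms by (intro mult_mono) auto
      then show ?thesis using assms by linarith
    qed
    ultimately have "a \<ge> t" by simp
    then have "a \<ge> 0" using assms by simp
    then have "a * a \<le> 1 * a" using a1 by (intro mult_right_mono) auto
    then have "a \<le> sqrt a" using \<open>a \<ge> 0\<close> by (intro real_le_rsqrt) (simp add: power2_eq_square)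
    then show ?thesis using False \<open>a \<ge> t\<close> \<open>a \<ge> 0\<close> lt by (simp add: a_def[symmetric] b_def[symmetric])
  qed
qed

text \<open>For lines that miss the disc, \<open>max 0\<close> makes the half-length 0 and the open
  interval empty, so no case distinction is left to the users.\<close>

lemma sheared_disc_section:
  "{y. vector [s, y] \<in> sheared_disc G} = {G s - sqrt (max 0 (1 - s\<^sup>2))<..<G s + sqrt (max 0 (1 - s\<^sup>2))}"
proof -
  have "s\<^sup>2 + (y - G s)\<^sup>2 < 1 \<longleftrightarrow> \<bar>y - G s\<bar> < sqrt (max 0 (1 - s\<^sup>2))" for y
  proof (cases "1 - s\<^sup>2 \<ge> 0")
    case True
    have "s\<^sup>2 + (y - G s)\<^sup>2 < 1 \<longleftrightarrow> sqrt ((y - G s)\<^sup>2) < sqrt (1 - s\<^sup>2)"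
      by (subst real_sqrt_less_iff) auto
    then show ?thesis using True by simp
  next
    case False
    then show ?thesis by (auto simp: not_less) (use zero_le_power2[of "y - G s"] in linarith)
  qed
  then have "vector [s, y] \<in> sheared_disc G \<longleftrightarrow> \<bar>y - G s\<bar> < sqrt (max 0 (1 - s\<^sup>2))" for y
    by (simp add: sheared_disc_def)
  then show ?thesis by (simp add: abs_diff_less_iff set_eq_iff algebra_simps conj_commute)
qed

lemma symdiff_measure_ge:
  fixes l \<gamma> :: real
  assumes G: "continuous_on UNIV G" "\<And>u. \<bar>G u\<bar> \<le> c"
    and l: "0 < l" "l \<le> 1" and \<gamma>: "0 < \<gamma>" "\<gamma> < 1/4"
  defines "\<Omega> \<equiv> sheared_disc G"
  defines "\<Omega>' \<equiv> reflection (axis 1 1) l ` \<Omega>"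
  shows "measure lebesgue {x \<in> sym_diff \<Omega> \<Omega>'. infdist x (hyperplane (axis 1 1) l) \<le> \<gamma>} \<ge> l * \<gamma>\<^sup>2 / 2"
proof -
  define e1 :: "real^2" where "e1 = axis 1 1"
  define A where "A = {x \<in> sym_diff \<Omega> \<Omega>'. infdist x (hyperplane e1 l) \<le> \<gamma>}"
  \<comment> \<open>To the right of the line, a reflected chord stems from abscissa
    \<open>l - t\<close>, closer to the centre than \<open>l + t\<close>, and is the longer one. So
    only points of \<Omega>' outside \<Omega> on that side are counted.\<close>
  define B where "B = (\<Omega>' - \<Omega>) \<inter> {x. l < x $ 1 \<and> x $ 1 < l + \<gamma>}"
  have ne: "norm e1 = 1" by (simp add: e1_def)
  have op: "open \<Omega>" unfolding \<Omega>_def by (rule open_sheared_disc[OF G(1)])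
  have \<Omega>'_eq: "\<Omega>' = reflection e1 l -` \<Omega>"
    unfolding \<Omega>'_def e1_def[symmetric] reflection_image[OF ne] by auto
  have op': "open \<Omega>'" unfolding \<Omega>'_eq by (rule open_vimage[OF op continuous_on_reflection])
  have bd: "bounded (\<Omega> \<union> \<Omega>')"
  proof -
    have b: "bounded \<Omega>" unfolding \<Omega>_def by (rule bounded_sheared_disc[OF G(2)])
    then have "compact (closure \<Omega>)" by (simp add: compact_closure)
    then have "bounded (reflection e1 l ` closure \<Omega>)"
      by (intro compact_imp_bounded compact_continuous_image continuous_on_reflection)
    then have "bounded \<Omega>'" unfolding \<Omega>'_def e1_def[symmetric]
      by (rule bounded_subset) (auto intro: closure_subset[THEN subsetD])
    with b show ?thesis by simp
  qed
  have Bb: "B \<in> sets borel"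
  proof -
    have "open {x::real^2. l < x $ 1 \<and> x $ 1 < l + \<gamma>}"
      by (intro open_Collect_conj open_Collect_less continuous_intros)
    then show ?thesis unfolding B_def using op op' by auto
  qed
  have Ab: "A \<in> sets borel"
  proof -
    have "closed {x. infdist x (hyperplane e1 l) \<le> \<gamma>}"
      by (intro closed_Collect_le continuous_intros)
    moreover have "A = sym_diff \<Omega> \<Omega>' \<inter> {x. infdist x (hyperplane e1 l) \<le> \<gamma>}"
      by (auto simp: A_def)
    ultimately show ?thesis using op op' by auto
  qed
  have BA: "B \<subseteq> A"
  proof
    fix x assume x: "x \<in> B"
    have "x - (x $ 1 - l) *\<^sub>R e1 \<in> hyperplane e1 l"
      by (simp add: hyperplane_def inner_diff_left e1_def inner_axis1 inner_axis_axis)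
    then have "infdist x (hyperplane e1 l) \<le> dist x (x - (x $ 1 - l) *\<^sub>R e1)"
      by (rule infdist_le)
    also have "\<dots> \<le> \<gamma>" using x ne by (auto simp: B_def dist_norm)
    finally show "x \<in> A" using x by (auto simp: A_def B_def)
  qed
  \<comment> \<open>For \<open>t \<ge> \<gamma> / 2\<close> the half-lengths differ by at least
    \<open>l * \<gamma> / 2\<close>, the sections by \<open>l * \<gamma>\<close>; the remaining
    strip has width \<open>\<gamma> / 2\<close>.\<close>
  have "ennreal (l * \<gamma> * (l + \<gamma> - (l + \<gamma> / 2))) \<le> emeasure lborel B"
  proof (rule emeasure_vec2_ge_sections[OF Bb])
    fix s assume s: "l + \<gamma> / 2 < s" "s < l + \<gamma>"
    define t where "t = s - l"
    have t: "0 < t" "t \<le> 1/4" "\<gamma> / 2 \<le> t" using s \<gamma> by (auto simp: t_def)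
    define r where "r = sqrt (max 0 (1 - s\<^sup>2))"
    define r' where "r' = sqrt (max 0 (1 - (2 * l - s)\<^sup>2))"
    have "l * t \<le> r' - r"
      using sqrt_chord_gap[OF l t(1,2)] by (simp add: r_def r'_def t_def algebra_simps)
    then have gap: "l * (\<gamma> / 2) \<le> r' - r"
      using mult_left_mono[OF t(3), of l] l by linarith
    have "0 \<le> l * (\<gamma> / 2)" using l \<gamma> by simp
    then have r: "0 \<le> r" "r \<le> r'" using gap by (simp_all add: r_def)
    have "{y. vector [s, y] \<in> B} = {y. vector [2 * l - s, y] \<in> \<Omega>} - {y. vector [s, y] \<in> \<Omega>}"
      using s \<gamma> by (auto simp: B_def \<Omega>'_eq e1_def reflection_axis1)
    also have "\<dots> = {G (2 * l - s) - r'<..<G (2 * l - s) + r'} - {G s - r<..<G s + r}"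
      unfolding \<Omega>_def sheared_disc_section r_def r'_def by simp
    finally have "emeasure lborel {y. vector [s, y] \<in> B} \<ge> ennreal (2 * (r' - r))"
      using emeasure_interval_diff_ge[OF r] by simp
    then show "ennreal (l * \<gamma>) \<le> emeasure lborel {y. vector [s, y] \<in> B}"
      by (rule order_trans[rotated]) (use gap in \<open>auto intro: ennreal_leI\<close>)
  qed (use l \<gamma> in auto)
  also have "\<dots> \<le> emeasure lborel A" by (intro emeasure_mono BA) (use Ab in simp)
  also have "\<dots> = emeasure lebesgue A" using Ab by simp
  finally have le: "ennreal (l * \<gamma>\<^sup>2 / 2) \<le> emeasure lebesgue A"
    by (simp add: power2_eq_square field_simps)
  \<comment> \<open>Finiteness matters: \<open>measure\<close> would be 0 on a set of infinite
    measure.\<close>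
  have "A \<in> lmeasurable"
    by (rule bounded_set_imp_lmeasurable[OF bounded_subset[OF bd]]) (use Ab in \<open>auto simp: A_def\<close>)
  then have "emeasure lebesgue A = ennreal (measure lebesgue A)" by (rule emeasure_eq_measure2)
  with le have "l * \<gamma>\<^sup>2 / 2 \<le> measure lebesgue A" by simp
  then show ?thesis unfolding A_def e1_def .
qed

text \<open>Where the upper boundary ascends, reflected caps stick out; hence \<open>p\<close> bounds the critical value.\<close>

lemma critical_value_bounds:
  fixes p D :: real
  assumes p: "0 < p" "p < 1/2" and D: "D > 0"
    and der: "((\<lambda>u. sqrt (1 - u\<^sup>2) + G u) has_real_derivative D) (at p)"
  shows "p \<le> critical_value (sheared_disc G) (axis 1 1)"
    and "critical_value (sheared_disc G) (axis 1 1) \<le> 1"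
proof -
  define \<Omega> where "\<Omega> = sheared_disc G"
  define \<Lambda> where "\<Lambda> = (SUP x\<in>\<Omega>. x $ 1)"
  define S where "S = {\<mu>'. \<forall>\<mu>\<in>{\<mu>'<..<\<Lambda>}. reflected_cap \<Omega> (axis 1 1) \<mu> \<subseteq> \<Omega>}"
  have cv: "critical_value \<Omega> (axis 1 1) = Inf S"
    by (simp add: critical_value_def inner_axis1 \<Lambda>_def S_def)
  have half: "vector [1/2, G (1/2)] \<in> \<Omega>" by (simp add: \<Omega>_def sheared_disc_def power2_eq_square)
  have le1: "x $ 1 \<le> 1" if "x \<in> \<Omega>" for x
  proof -
    have "(x $ 1)\<^sup>2 \<le> 1" using that zero_le_power2[of "x $ 2 - G (x $ 1)"]
      unfolding \<Omega>_def sheared_disc_def mem_Collect_eq by linarith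
    then show ?thesis using power2_le_imp_le[of "x $ 1" 1] by simp
  qed
  then have bdd: "bdd_above ((\<lambda>x. x $ 1) ` \<Omega>)" by (auto simp: bdd_above_def)
  have \<Lambda>: "1/2 \<le> \<Lambda>" "\<Lambda> \<le> 1"
    using cSUP_upper[OF half bdd] le1 half by (auto simp: \<Lambda>_def intro!: cSUP_least)
  have ge: "p \<le> \<mu>" if "\<mu> \<in> S" for \<mu>
  proof (rule ccontr)
    assume "\<not> p \<le> \<mu>"
    \<comment> \<open>A member of \<open>S\<close> below \<open>p\<close> would make
      \<open>p\<close> itself an admissible position, as
      \<open>p < 1/2 \<le> \<Lambda>\<close>.\<close>
    then have cap: "reflected_cap \<Omega> (axis 1 1) p \<subseteq> \<Omega>"
      using that \<Lambda> p by (auto simp: S_def)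
    define f where "f u = sqrt (1 - u\<^sup>2) + G u" for u
    have der: "(f has_real_derivative D) (at p)" using der by (simp add: f_def[abs_def])
    obtain a where a: "a > 0" "\<And>h. 0 < h \<Longrightarrow> h < a \<Longrightarrow> f p < f (p + h)"
      using DERIV_pos_inc_right[OF der D] by auto
    obtain b where b: "b > 0" "\<And>h. 0 < h \<Longrightarrow> h < b \<Longrightarrow> f (p - h) < f p"
      using DERIV_pos_inc_left[OF der D] by auto
    define h where "h = min (min a b) p / 2"
    have h: "0 < h" "h < a" "h < b" "h < p" using a b p by (auto simp: h_def min_def)
    have f: "f (p - h) < f (p + h)" using a(2)[OF h(1,2)] b(2)[OF h(1,3)] by simp
    have bnd: "\<bar>p + h\<bar> < 1" "\<bar>p - h\<bar> < 1" using h p by auto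
    then have sq: "1 - (p + h)\<^sup>2 > 0" "1 - (p - h)\<^sup>2 > 0"
      using abs_square_less_1[of "p + h"] abs_square_less_1[of "p - h"] by simp_all
    \<comment> \<open>This height lies inside the section at \<open>p + h\<close>, above its centre
      and below its top, but not below the top of the section at \<open>p - h\<close>; so the
      reflected point leaves \<Omega>.\<close>
    define y where "y = max (f (p - h)) (G (p + h))"
    have y: "f (p - h) \<le> y" "G (p + h) \<le> y" "y < f (p + h)"
      using f sq by (auto simp: y_def f_def)
    have s1: "sqrt (max 0 (1 - (p + h)\<^sup>2)) = sqrt (1 - (p + h)\<^sup>2)"
      "sqrt (max 0 (1 - (p - h)\<^sup>2)) = sqrt (1 - (p - h)\<^sup>2)" using sq by auto
    have sp: "sqrt (1 - (p + h)\<^sup>2) > 0" using sq by simp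
    have "y \<in> {y. vector [p + h, y] \<in> \<Omega>}"
      unfolding \<Omega>_def sheared_disc_section s1 using y sp by (auto simp: f_def)
    then have "vector [p + h, y] \<in> \<Omega> \<inter> {x. x \<bullet> axis 1 1 > p}" using h by (simp add: inner_axis1)
    then have "reflection (axis 1 1) p (vector [p + h, y]) \<in> \<Omega>"
      using cap by (auto simp: reflected_cap_def)
    then have "y \<in> {y. vector [p - h, y] \<in> \<Omega>}" by (simp add: reflection_axis1)
    then show False unfolding \<Omega>_def sheared_disc_section s1 using y by (auto simp: f_def)
  qed
  \<comment> \<open>The condition is vacuous over the empty interval from \<Lambda> to \<Lambda>.
    This makes \<open>S\<close> nonempty and its infimum at most \<Lambda>.\<close>
  have "\<Lambda> \<in> S" by (simp add: S_def)
  then show "p \<le> critical_value (sheared_disc G) (axis 1 1)"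
    unfolding \<Omega>_def[symmetric] cv by (intro cInf_greatest ge) auto
  have "bdd_below S" using ge by (auto simp: bdd_below_def)
  then have "Inf S \<le> \<Lambda>" using \<open>\<Lambda> \<in> S\<close> cInf_lower by blast
  then show "critical_value (sheared_disc G) (axis 1 1) \<le> 1"
    unfolding \<Omega>_def[symmetric] cv using \<Lambda> by simp
qed

subsection \<open>The boundary of a sheared disc as a local graph\<close>

lemma lipschitz_of_deriv:
  fixes f :: "real \<Rightarrow> real"
  assumes "\<And>x. (f has_real_derivative f' x) (at x)" "\<And>x. \<bar>f' x\<bar> \<le> C"
  shows "\<bar>f a - f b\<bar> \<le> C * \<bar>a - b\<bar>"
  using field_differentiable_bound[of UNIV f f' C a b] assms
  by (simp add: abs_minus_commute)

lemma norm_vec2: "norm (x :: real^2) = sqrt ((x $ 1)\<^sup>2 + (x $ 2)\<^sup>2)"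
  by (simp add: norm_vec_def L2_set_def sum_2)

lemma inner_vec2: "(x :: real^2) \<bullet> y = x $ 1 * y $ 1 + x $ 2 * y $ 2"
  by (simp add: inner_vec_def sum_2)

text \<open>The expression is the defining function of the sheared disc at normal distance
  \<open>h\<close> from a boundary point: \<open>A\<close> is the radial component of the normal and
  \<Delta> the increment of the wave. For \<open>h < 0\<close>, the linear term is at most
  \<open>- 8/5 * \<bar>h\<bar>\<close>, while the others add up to less than
  \<open>1.31 * \<bar>h\<bar>\<close>; for \<open>h \<ge> 0\<close>, the term
  \<open>h\<^sup>2\<close> has the right sign.\<close>

lemma quadratic_sign:
  fixes h A a b \<Delta> :: real
  assumes A: "A \<ge> 4/5" and \<Delta>: "\<bar>\<Delta>\<bar> \<le> \<bar>h\<bar> / 100" and ab: "\<bar>a\<bar> \<le> 1" "\<bar>b\<bar> \<le> 1" and h: "\<bar>h\<bar> \<le> 5/4"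
  shows "2 * h * A - 2 * a * \<Delta> + h\<^sup>2 - 2 * h * b * \<Delta> + \<Delta>\<^sup>2 < 0 \<longleftrightarrow> h < 0"
proof -
  have "\<bar>a * \<Delta>\<bar> \<le> 1 * (\<bar>h\<bar> / 100)" unfolding abs_mult using ab \<Delta> by (intro mult_mono) auto
  then have 1: "\<bar>a * \<Delta>\<bar> \<le> \<bar>h\<bar> / 100" by simp
  have "\<bar>b * \<Delta>\<bar> \<le> 1 * (\<bar>h\<bar> / 100)" unfolding abs_mult using ab \<Delta> by (intro mult_mono) auto
  then have "\<bar>h\<bar> * \<bar>b * \<Delta>\<bar> \<le> \<bar>h\<bar> * (\<bar>h\<bar> / 100)" by (intro mult_left_mono) auto
  then have 2: "\<bar>h * b * \<Delta>\<bar> \<le> h\<^sup>2 / 100" by (simp add: abs_mult mult.assoc power2_eq_square)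
  have "\<bar>\<Delta>\<bar> * \<bar>\<Delta>\<bar> \<le> (\<bar>h\<bar> / 100) * (\<bar>h\<bar> / 100)" using \<Delta> by (intro mult_mono) auto
  then have "\<Delta>\<^sup>2 \<le> h\<^sup>2 / 10000" by (simp add: power2_eq_square flip: abs_mult)
  then have 3: "\<Delta>\<^sup>2 \<le> h\<^sup>2 / 100" using zero_le_power2[of h] by linarith
  have "\<bar>h\<bar> * \<bar>h\<bar> \<le> 5/4 * \<bar>h\<bar>" using h by (intro mult_right_mono) auto
  then have 4: "h\<^sup>2 \<le> 5/4 * \<bar>h\<bar>" by (simp add: power2_eq_square)
  have 5: "h\<^sup>2 \<ge> 0" "\<Delta>\<^sup>2 \<ge> 0" by simp_all
  have eq: "2 * h * A - 2 * a * \<Delta> + h\<^sup>2 - 2 * h * b * \<Delta> + \<Delta>\<^sup>2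
      = 2 * (h * A) - 2 * (a * \<Delta>) + h\<^sup>2 - 2 * (h * b * \<Delta>) + \<Delta>\<^sup>2" by simp
  show ?thesis
  proof (cases "h < 0")
    case True
    then have "h * A \<le> h * (4/5)" using A by (intro mult_left_mono_neg) auto
    then show ?thesis unfolding eq using 1 2 3 4 5 True by linarith
  next
    case False
    then have "h * A \<ge> h * (4/5)" using A by (intro mult_left_mono) auto
    then show ?thesis unfolding eq using 1 2 3 4 5 False by linarith
  qed
qed

lemma cos_ge:
  fixes t :: real
  assumes t: "\<bar>t\<bar> \<le> 1/2"
  shows "cos t \<ge> 7/8"
proof -
  have "\<bar>sin (t / 2)\<bar> \<le> 1/4" using abs_sin_x_le_abs_x[of "t / 2"] t by simp
  then have "(sin (t / 2))\<^sup>2 \<le> (1/4)\<^sup>2" by (metis abs_ge_zero power2_abs power_mono)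
  then show "cos t \<ge> 7/8" using cos_double_sin[of "t / 2"] by (simp add: power2_eq_square)
qed

text \<open>Slope at most 1/100 keeps the normals so close to those of the circle that all constants
  below are numerical.\<close>

locale small_shear =
  fixes G G' :: "real \<Rightarrow> real"
  assumes G: "\<And>u. (G has_real_derivative G' u) (at u)"
    and G'_small: "\<And>u. \<bar>G' u\<bar> \<le> 1/100"
    and G'_cont: "continuous_on UNIV G'"
begin

text \<open>The boundary of \<open>sheared_disc G\<close> is traced out by \<open>(cos \<theta>, sin \<theta> + G (cos \<theta>))\<close>. In the frame of
  the unit normal \<open>(nx, ny)\<close> and the tangent at parameter \<open>\<theta>\<close>, the point with parameter \<open>\<theta> + t\<close> has
  tangential coordinate \<open>X \<theta> t\<close> relative to the base point and normal coordinate \<open>Y \<theta> t\<close> relative to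
  the origin, since the class \<open>C\<^sup>\<alpha>\<close> compares \<open>y \<bullet> \<nu>\<close>, not \<open>(y - x) \<bullet> \<nu>\<close>, with \<open>\<psi>\<close>.\<close>

definition len where "len \<theta> = sqrt ((cos \<theta> - G' (cos \<theta>) * sin \<theta>)\<^sup>2 + (sin \<theta>)\<^sup>2)"
definition nx where "nx \<theta> = (cos \<theta> - G' (cos \<theta>) * sin \<theta>) / len \<theta>"
definition ny where "ny \<theta> = sin \<theta> / len \<theta>"
definition X where "X \<theta> t = - ny \<theta> * (cos (\<theta> + t) - cos \<theta>)
   + nx \<theta> * (sin (\<theta> + t) + G (cos (\<theta> + t)) - (sin \<theta> + G (cos \<theta>)))"
definition Y where "Y \<theta> t = nx \<theta> * cos (\<theta> + t) + ny \<theta> * (sin (\<theta> + t) + G (cos (\<theta> + t)))"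
definition X' where "X' \<theta> t = ny \<theta> * sin (\<theta> + t)
   + nx \<theta> * (cos (\<theta> + t) - G' (cos (\<theta> + t)) * sin (\<theta> + t))"

lemma G_lipschitz: "\<bar>G u - G v\<bar> \<le> \<bar>u - v\<bar> / 100"
  using lipschitz_of_deriv[OF G G'_small, of u v] by simp

lemma G_cont: "continuous_on S G"
  using G by (meson DERIV_continuous continuous_at_imp_continuous_on)

lemma G'_mult: "\<bar>a\<bar> \<le> 1 \<Longrightarrow> \<bar>G' u * a\<bar> \<le> 1/100"
  using mult_mono[OF G'_small[of u], of "\<bar>a\<bar>" 1] by (simp add: abs_mult)

text \<open>\<open>len\<close> is the speed of the boundary curve. It is the norm of a unit vector
  altered by a horizontal vector of length at most 1/100.\<close>

lemma len_bounds: "99/100 \<le> len \<theta>" "len \<theta> \<le> 101/100"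
proof -
  define g where "g = G' (cos \<theta>) * sin \<theta>"
  have g: "\<bar>g\<bar> \<le> 1/100" unfolding g_def by (rule G'_mult) simp
  have "len \<theta> = norm (vector [cos \<theta>, sin \<theta>] - g *\<^sub>R axis 1 1 :: real^2)"
    by (simp add: len_def norm_vec2 g_def axis_def)
  moreover have "norm (vector [cos \<theta>, sin \<theta>] :: real^2) = 1" by (simp add: norm_vec2)
  moreover have "norm (g *\<^sub>R axis 1 1 :: real^2) \<le> 1/100" using g by simp
  ultimately show "99/100 \<le> len \<theta>" "len \<theta> \<le> 101/100"
    using norm_triangle_ineq2[of "vector [cos \<theta>, sin \<theta>]" "g *\<^sub>R axis 1 1 :: real^2"]
      norm_triangle_ineq4[of "vector [cos \<theta>, sin \<theta>]" "g *\<^sub>R axis 1 1 :: real^2"] by linarith+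
qed

lemma len_mult:
  "len \<theta> * nx \<theta> = cos \<theta> - G' (cos \<theta>) * sin \<theta>" "len \<theta> * ny \<theta> = sin \<theta>"
  using len_bounds(1)[of \<theta>] by (simp_all add: nx_def ny_def)

lemma unit_normal: "(nx \<theta>)\<^sup>2 + (ny \<theta>)\<^sup>2 = 1" "\<bar>nx \<theta>\<bar> \<le> 1" "\<bar>ny \<theta>\<bar> \<le> 1"
proof -
  have "(len \<theta>)\<^sup>2 * ((nx \<theta>)\<^sup>2 + (ny \<theta>)\<^sup>2) = (len \<theta> * nx \<theta>)\<^sup>2 + (len \<theta> * ny \<theta>)\<^sup>2"
    by (simp add: power_mult_distrib algebra_simps)
  also have "\<dots> = (len \<theta>)\<^sup>2 * 1" unfolding len_mult by (simp add: len_def)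
  finally have "(len \<theta>)\<^sup>2 * ((nx \<theta>)\<^sup>2 + (ny \<theta>)\<^sup>2) = (len \<theta>)\<^sup>2 * 1" .
  moreover have "(len \<theta>)\<^sup>2 \<noteq> 0" using len_bounds(1)[of \<theta>] by simp
  ultimately show *: "(nx \<theta>)\<^sup>2 + (ny \<theta>)\<^sup>2 = 1" using mult_left_cancel by blast
  show "\<bar>nx \<theta>\<bar> \<le> 1" "\<bar>ny \<theta>\<bar> \<le> 1"
    using * zero_le_power2[of "nx \<theta>"] zero_le_power2[of "ny \<theta>"]
    unfolding abs_square_le_1[symmetric] by linarith+
qed

text \<open>Without the wave this inner product would be \<open>cos t\<close>, by the addition
  formula. The wave changes it by at most 1/100 before the division by \<open>len\<close>, and
  \<open>(7/8 - 1/100) / (101/100)\<close> exceeds 4/5.\<close>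

lemma normal_radial:
  assumes "\<bar>t\<bar> \<le> 1/2"
  shows "nx \<theta> * cos (\<theta> + t) + ny \<theta> * sin (\<theta> + t) \<ge> 4/5"
proof -
  define g where "g = G' (cos \<theta>) * (sin \<theta> * cos (\<theta> + t))"
  have "\<bar>sin \<theta> * cos (\<theta> + t)\<bar> \<le> 1"
    using mult_mono[of "\<bar>sin \<theta>\<bar>" 1 "\<bar>cos (\<theta> + t)\<bar>" 1] by (simp add: abs_mult)
  then have g: "\<bar>g\<bar> \<le> 1/100" unfolding g_def by (rule G'_mult)
  have "cos t = cos ((\<theta> + t) - \<theta>)" by simp
  also have "\<dots> = cos (\<theta> + t) * cos \<theta> + sin (\<theta> + t) * sin \<theta>" by (rule cos_diff)
  finally have "cos t - g = (cos \<theta> - G' (cos \<theta>) * sin \<theta>) * cos (\<theta> + t) + sin \<theta> * sin (\<theta> + t)"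
    by (simp add: g_def algebra_simps)
  moreover have "4/5 * len \<theta> \<le> cos t - g"
    using cos_ge[OF assms] g len_bounds(2)[of \<theta>] by linarith
  ultimately have "4/5 \<le> ((cos \<theta> - G' (cos \<theta>) * sin \<theta>) * cos (\<theta> + t) + sin \<theta> * sin (\<theta> + t)) / len \<theta>"
    using len_bounds(1)[of \<theta>] by (simp add: pos_le_divide_eq)
  then show ?thesis by (simp add: nx_def ny_def add_divide_distrib)
qed

text \<open>\<open>X'\<close> is the inner product in \<open>normal_radial\<close> up to a wave term
  of size at most 1/100. The tangential coordinate is thus invertible on a range of angles that does
  not shrink with the wavelength.\<close>

lemma X'_ge:
  assumes "\<bar>t\<bar> \<le> 1/2"
  shows "X' \<theta> t \<ge> 1/2"
proof -
  have "\<bar>nx \<theta> * sin (\<theta> + t)\<bar> \<le> 1"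
    using mult_mono[OF unit_normal(2), of "\<bar>sin (\<theta> + t)\<bar>" 1] by (simp add: abs_mult)
  then have "\<bar>G' (cos (\<theta> + t)) * (nx \<theta> * sin (\<theta> + t))\<bar> \<le> 1/100" by (rule G'_mult)
  then show ?thesis using normal_radial[OF assms, of \<theta>] by (simp add: X'_def algebra_simps abs_le_iff)
qed

lemma DERIV_X: "(X \<theta> has_real_derivative X' \<theta> t) (at t)"
proof -
  have "((\<lambda>t. G (cos (\<theta> + t))) has_real_derivative G' (cos (\<theta> + t)) * - sin (\<theta> + t)) (at t)"
    by (rule DERIV_chain2[OF G]) (auto intro!: derivative_eq_intros)
  then show ?thesis unfolding X_def[abs_def] X'_def
    by (auto intro!: derivative_eq_intros simp: algebra_simps)
qed

text \<open>Slope at least 1/2 over an angle of 1/4 on either side covers all coordinates up to 1/8,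
  the radius in the theorem.\<close>

lemma X_inverse:
  assumes "\<bar>s\<bar> < 1/8"
  shows "\<exists>t. \<bar>t\<bar> < 1/2 \<and> X \<theta> t = s"
proof -
  have X0: "X \<theta> 0 = 0" by (simp add: X_def)
  have r: "X \<theta> (1/4) \<ge> 1/8"
  proof -
    obtain z where "0 < z" "z < 1/4" "X \<theta> (1/4) - X \<theta> 0 = (1/4 - 0) * X' \<theta> z"
      using MVT2[of 0 "1/4" "X \<theta>" "X' \<theta>"] DERIV_X by auto
    then show ?thesis using X'_ge[of z \<theta>] X0 by simp
  qed
  have l: "X \<theta> (- 1/4) \<le> - 1/8"
  proof -
    obtain z where "- 1/4 < z" "z < 0" "X \<theta> 0 - X \<theta> (- 1/4) = (0 - (- 1/4)) * X' \<theta> z"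
      using MVT2[of "- 1/4" 0 "X \<theta>" "X' \<theta>"] DERIV_X by auto
    then show ?thesis using X'_ge[of z \<theta>] X0 by simp
  qed
  have "\<exists>t\<ge>- 1/4. t \<le> 1/4 \<and> X \<theta> t = s"
    using l r assms DERIV_isCont[OF DERIV_X] by (intro IVT) auto
  then obtain t where "- 1/4 \<le> t" "t \<le> 1/4" "X \<theta> t = s" by blast
  then show ?thesis by (intro exI[of _ t]) auto
qed

definition T where "T \<theta> s = (SOME t. \<bar>t\<bar> < 1/2 \<and> X \<theta> t = s)"

lemma X_T: "\<bar>s\<bar> < 1/8 \<Longrightarrow> \<bar>T \<theta> s\<bar> < 1/2 \<and> X \<theta> (T \<theta> s) = s"
  unfolding T_def by (rule someI_ex[OF X_inverse])

abbreviation "curve \<theta> \<equiv> vector [cos \<theta>, sin \<theta> + G (cos \<theta>)] :: real^2"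
abbreviation "normal \<theta> \<equiv> vector [nx \<theta>, ny \<theta>] :: real^2"
abbreviation "tangent \<theta> \<equiv> vector [- ny \<theta>, nx \<theta>] :: real^2"

lemma frontier_curve:
  assumes "x \<in> frontier (sheared_disc G)"
  obtains \<theta> where "x = curve \<theta>"
proof -
  define F where "F y = (y $ 1)\<^sup>2 + (y $ 2 - G (y $ 1))\<^sup>2" for y :: "real^2"
  have cF: "continuous_on UNIV F" unfolding F_def
    by (intro continuous_intros continuous_on_compose2[OF G_cont]) auto
  have "x \<notin> sheared_disc G"
    using assms open_sheared_disc[OF G_cont] by (simp add: frontier_def interior_open)
  then have "F x \<ge> 1" by (simp add: F_def sheared_disc_def)
  moreover have "F x \<le> 1"
  proof -
    have "closed {y. F y \<le> 1}" using cF by (intro closed_Collect_le) auto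
    then have "closure (sheared_disc G) \<subseteq> {y. F y \<le> 1}"
      by (intro closure_minimal) (auto simp: F_def sheared_disc_def)
    then show ?thesis using assms by (auto simp: frontier_def)
  qed
  ultimately have "(x $ 1)\<^sup>2 + (x $ 2 - G (x $ 1))\<^sup>2 = 1" by (simp add: F_def)
  then obtain \<theta> where \<theta>: "x $ 1 = cos \<theta>" "x $ 2 - G (x $ 1) = sin \<theta>"
    using sincos_total_2pi by metis
  have "x = curve \<theta>"
    unfolding vec_eq_iff forall_2 using \<theta> by (simp add: algebra_simps)
  then show ?thesis by (rule that)
qed

section \<open>The outward normal as a normalised gradient\<close>

lemma GDERIV_defining_function:
  "GDERIV (\<lambda>y :: real^2. (y $ 1)\<^sup>2 + (y $ 2 - G (y $ 1))\<^sup>2 - 1) y :>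
    vector [2 * y $ 1 - 2 * (y $ 2 - G (y $ 1)) * G' (y $ 1), 2 * (y $ 2 - G (y $ 1))]"
proof -
  have p: "((\<lambda>y :: real^2. y $ i) has_derivative (\<lambda>h. h $ i)) (at y)" for i
    by (rule bounded_linear_imp_has_derivative) (rule bounded_linear_vec_nth)
  have g: "((\<lambda>y :: real^2. G (y $ 1)) has_derivative (\<lambda>h. G' (y $ 1) * h $ 1)) (at y)"
    by (rule has_derivative_compose[OF p G[unfolded has_field_derivative_def]])
  have "((\<lambda>y :: real^2. (y $ 1)\<^sup>2 + (y $ 2 - G (y $ 1))\<^sup>2 - 1) has_derivative
     (\<lambda>h. 2 * y $ 1 * h $ 1 + 2 * (y $ 2 - G (y $ 1)) * (h $ 2 - G' (y $ 1) * h $ 1))) (at y)"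
    by (auto intro!: derivative_eq_intros p g simp: algebra_simps)
  then show ?thesis
    unfolding gderiv_def by (rule has_derivative_eq_rhs) (auto simp: inner_vec2 algebra_simps)
qed

text \<open>A vanishing second component gives \<open>y $ 2 = G (y $ 1)\<close>, then the first one
  gives \<open>y $ 1 = 0\<close>: the gradient vanishes only at the sheared centre.\<close>

lemma gradient_nonzero:
  assumes "(y $ 1)\<^sup>2 + (y $ 2 - G (y $ 1))\<^sup>2 > 0"
  shows "vector [2 * y $ 1 - 2 * (y $ 2 - G (y $ 1)) * G' (y $ 1), 2 * (y $ 2 - G (y $ 1))] \<noteq> (0 :: real^2)"
proof
  assume "vector [2 * y $ 1 - 2 * (y $ 2 - G (y $ 1)) * G' (y $ 1), 2 * (y $ 2 - G (y $ 1))] = (0 :: real^2)"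
  then have "y $ 2 - G (y $ 1) = 0" "2 * y $ 1 - 2 * (y $ 2 - G (y $ 1)) * G' (y $ 1) = 0"
    by (simp_all add: vec_eq_iff forall_2)
  then show False using assms by simp
qed

lemma outward_normal:
  assumes "curve \<theta> \<in> frontier (sheared_disc G)"
  shows "outward_unit_normal (sheared_disc G) (curve \<theta>) (normal \<theta>)"
proof -
  define F where "F y = (y $ 1)\<^sup>2 + (y $ 2 - G (y $ 1))\<^sup>2 - 1" for y :: "real^2"
  define g :: "real^2 \<Rightarrow> real^2" where
    "g y = vector [2 * y $ 1 - 2 * (y $ 2 - G (y $ 1)) * G' (y $ 1), 2 * (y $ 2 - G (y $ 1))]" for y
  define U where "U = {y :: real^2. (y $ 1)\<^sup>2 + (y $ 2 - G (y $ 1))\<^sup>2 > 0}"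
  have c: "continuous_on UNIV (\<lambda>y :: real^2. G (y $ 1))" "continuous_on UNIV (\<lambda>y :: real^2. G' (y $ 1))"
    by (rule continuous_on_compose2[OF G_cont[of UNIV]] continuous_on_compose2[OF G'_cont];
        auto intro: continuous_intros)+
  have oU: "open U" unfolding U_def by (intro open_Collect_less continuous_intros c)
  have eq: "vector [a, b] = a *\<^sub>R axis 1 1 + b *\<^sub>R (axis 2 1 :: real^2)" for a b
    by (simp add: vec_eq_iff forall_2) (simp add: axis_def)
  have cg: "continuous_on UNIV g" unfolding g_def eq by (intro continuous_intros c)
  have gc: "g (curve \<theta>) = (2 * len \<theta>) *\<^sub>R normal \<theta>"
    by (simp add: g_def vec_eq_iff forall_2 mult.assoc mult.left_commute[of _ 2] len_mult)
  have nn: "norm (normal \<theta>) = 1" using unit_normal(1)[of \<theta>] by (simp add: norm_vec2)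
  have "sgn (g (curve \<theta>)) = normal \<theta>"
    unfolding gc using len_bounds(1)[of \<theta>] nn by (simp add: sgn_div_norm)
  moreover have "curve \<theta> \<in> U" by (simp add: U_def)
  moreover have "sheared_disc G \<inter> U = {y \<in> U. F y < 0}"
    by (auto simp: sheared_disc_def F_def)
  moreover have "GDERIV F y :> g y" for y
    unfolding F_def[abs_def] g_def by (rule GDERIV_defining_function)
  moreover have "g y \<noteq> 0" if "y \<in> U" for y
    unfolding g_def by (rule gradient_nonzero) (use that in \<open>simp add: U_def\<close>)
  ultimately show ?thesis
    unfolding outward_unit_normal_def
    using assms oU continuous_on_subset[OF cg subset_UNIV, of U]
    by (intro conjI exI[of _ U] exI[of _ F] exI[of _ g]) auto
qed

text \<open>A point of the ball is the graph point \<open>z\<close> over its tangential coordinate plus \<open>h\<close> times the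
  normal. The defining function vanishes at \<open>z\<close> and is dominated by the term linear in \<open>h\<close>.\<close>

lemma local_graph:
  "ball (curve \<theta>) (1/8) \<inter> sheared_disc G = {y \<in> ball (curve \<theta>) (1/8).
     y \<bullet> normal \<theta> < Y \<theta> (T \<theta> (tangent_projection (normal \<theta>) (curve \<theta>) y \<bullet> tangent \<theta>))}"
proof -
  have "y \<in> sheared_disc G \<longleftrightarrow>
      y \<bullet> normal \<theta> < Y \<theta> (T \<theta> (tangent_projection (normal \<theta>) (curve \<theta>) y \<bullet> tangent \<theta>))"
    if y: "y \<in> ball (curve \<theta>) (1/8)" for y
  proof -
    have u: "nx \<theta> * nx \<theta> + ny \<theta> * ny \<theta> = 1" using unit_normal(1)[of \<theta>] by (simp add: power2_eq_square)
    have nn: "norm (normal \<theta>) = 1" "norm (tangent \<theta>) = 1"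
      using unit_normal(1)[of \<theta>] by (simp_all add: norm_vec2 add.commute)
    have d: "norm (y - curve \<theta>) < 1/8" using y by (simp add: dist_norm norm_minus_commute)
    have cs: "\<bar>(y - curve \<theta>) \<bullet> v\<bar> < 1/8" if "norm v = 1" for v
      using Cauchy_Schwarz_ineq2[of "y - curve \<theta>" v] that d by simp
    define s where "s = (y - curve \<theta>) \<bullet> tangent \<theta>"
    have tp: "tangent_projection (normal \<theta>) (curve \<theta>) y \<bullet> tangent \<theta> = s"
      by (simp add: tangent_projection_def s_def inner_diff_left inner_vec2 algebra_simps)
    define t where "t = T \<theta> s"
    have t: "\<bar>t\<bar> < 1/2" "X \<theta> t = s" using X_T[of s \<theta>] cs[OF nn(2)] by (auto simp: t_def s_def)
    define c where "c = cos (\<theta> + t)"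
    define z where "z = sin (\<theta> + t)"
    define h where "h = y \<bullet> normal \<theta> - Y \<theta> t"
    have n1: "(y $ 1 - c) * - ny \<theta> + (y $ 2 - (z + G c)) * nx \<theta> = 0"
      using t(2) by (simp add: s_def X_def inner_vec2 c_def z_def algebra_simps)
    have n2: "(y $ 1 - c) * nx \<theta> + (y $ 2 - (z + G c)) * ny \<theta> = h"
      by (simp add: h_def Y_def inner_vec2 c_def z_def algebra_simps)
    \<comment> \<open>Solving the two coordinate equations in the orthonormal frame expresses
      \<open>y\<close> as the graph point plus \<open>h\<close> times the normal.\<close>
    have y1: "y $ 1 = c + h * nx \<theta>" and y2: "y $ 2 = z + G c + h * ny \<theta>"
      using n1 n2 u by algebra+
    define \<Delta> where "\<Delta> = G (y $ 1) - G c"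
    have \<Delta>: "\<bar>\<Delta>\<bar> \<le> \<bar>h\<bar> / 100"
    proof -
      have "\<bar>h * nx \<theta>\<bar> \<le> \<bar>h\<bar>" using mult_left_mono[OF unit_normal(2)[of \<theta>], of "\<bar>h\<bar>"] by (simp add: abs_mult)
      then show ?thesis using G_lipschitz[of "y $ 1" c] by (simp add: \<Delta>_def y1)
    qed
    \<comment> \<open>The base point is within 1/8 of \<open>y\<close>, and the graph point within
      1/2 and 505/1000 of the base point in the two coordinates; the sum stays below 5/4.\<close>
    have hb: "\<bar>h\<bar> \<le> 5/4"
    proof -
      define a where "a = c - cos \<theta>"
      define b where "b = z + G c - (sin \<theta> + G (cos \<theta>))"
      have a: "\<bar>a\<bar> \<le> 1/2"
        using lipschitz_of_deriv[of cos "\<lambda>x. - sin x" 1 "\<theta> + t" \<theta>] t(1)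
        by (simp add: DERIV_cos a_def c_def)
      have "\<bar>z - sin \<theta>\<bar> \<le> 1/2"
        using lipschitz_of_deriv[of sin cos 1 "\<theta> + t" \<theta>] t(1) by (simp add: DERIV_sin z_def)
      moreover have "b = (z - sin \<theta>) + (G c - G (cos \<theta>))" by (simp add: b_def)
      moreover have "\<bar>G c - G (cos \<theta>)\<bar> \<le> 5/1000"
        by (rule order_trans[OF G_lipschitz]) (use a in \<open>simp add: a_def\<close>)
      ultimately have b: "\<bar>b\<bar> \<le> 505/1000"
        using abs_triangle_ineq[of "z - sin \<theta>" "G c - G (cos \<theta>)"] by simp
      have "h = (y - curve \<theta>) \<bullet> normal \<theta> - (a * nx \<theta> + b * ny \<theta>)"
        by (simp add: n2[symmetric] inner_vec2 a_def b_def algebra_simps)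
      moreover have "\<bar>a * nx \<theta>\<bar> \<le> 1/2 * 1"
        unfolding abs_mult by (intro mult_mono a unit_normal) auto
      moreover have "\<bar>b * ny \<theta>\<bar> \<le> 505/1000 * 1"
        unfolding abs_mult by (intro mult_mono b unit_normal) auto
      ultimately show ?thesis using cs[OF nn(1)] by linarith
    qed
    have "c\<^sup>2 + z\<^sup>2 = 1" by (simp add: c_def z_def)
    then have "(y $ 1)\<^sup>2 + (y $ 2 - G (y $ 1))\<^sup>2 - 1
        = 2 * h * (nx \<theta> * c + ny \<theta> * z) - 2 * z * \<Delta> + h\<^sup>2 - 2 * h * ny \<theta> * \<Delta> + \<Delta>\<^sup>2"
      using unit_normal(1)[of \<theta>] unfolding \<Delta>_def y1[symmetric] using y1 y2 by algebra
    moreover have "nx \<theta> * c + ny \<theta> * z \<ge> 4/5"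
      unfolding c_def z_def using t(1) by (intro normal_radial) simp
    moreover have "\<bar>z\<bar> \<le> 1" by (simp add: z_def)
    ultimately have "(y $ 1)\<^sup>2 + (y $ 2 - G (y $ 1))\<^sup>2 - 1 < 0 \<longleftrightarrow> h < 0"
      using quadratic_sign \<Delta> hb unit_normal(3) by presburger
    then show ?thesis unfolding tp by (simp add: sheared_disc_def h_def t_def)
  qed
  then show ?thesis by blast
qed

end

subsection \<open>Sheared discs with an oscillating boundary\<close>

text \<open>The phase is chosen such that the wave has its maximal slope at \<open>u = slope \<alpha> \<epsilon> / 4\<close>, where it
  beats the slope of the unit circle.\<close>

definition wavelength :: "real \<Rightarrow> real \<Rightarrow> real" where "wavelength \<alpha> \<epsilon> = \<epsilon> powr (1 / \<alpha>)"
definition slope :: "real \<Rightarrow> real \<Rightarrow> real" where "slope \<alpha> \<epsilon> = \<epsilon> powr (1 - 1 / \<alpha>)"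
definition wave :: "real \<Rightarrow> real \<Rightarrow> real \<Rightarrow> real" where
  "wave \<alpha> \<epsilon> u = \<epsilon> * sin ((u - slope \<alpha> \<epsilon> / 4) / wavelength \<alpha> \<epsilon>)"
definition wave' :: "real \<Rightarrow> real \<Rightarrow> real \<Rightarrow> real" where
  "wave' \<alpha> \<epsilon> u = slope \<alpha> \<epsilon> * cos ((u - slope \<alpha> \<epsilon> / 4) / wavelength \<alpha> \<epsilon>)"

lemma wavelength_pos: "\<epsilon> > 0 \<Longrightarrow> wavelength \<alpha> \<epsilon> > 0"
  by (simp add: wavelength_def)

lemma slope_pos: "\<epsilon> > 0 \<Longrightarrow> slope \<alpha> \<epsilon> > 0"
  by (simp add: slope_def)

lemma slope_wavelength: "\<epsilon> > 0 \<Longrightarrow> slope \<alpha> \<epsilon> * wavelength \<alpha> \<epsilon> = \<epsilon>"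
  by (simp add: slope_def wavelength_def flip: powr_add)

lemma DERIV_wave:
  assumes "\<epsilon> > 0"
  shows "(wave \<alpha> \<epsilon> has_real_derivative wave' \<alpha> \<epsilon> u) (at u)"
proof -
  define c where "c = cos ((u - slope \<alpha> \<epsilon> / 4) / wavelength \<alpha> \<epsilon>)"
  have "(wave \<alpha> \<epsilon> has_real_derivative \<epsilon> * (c * (1 / wavelength \<alpha> \<epsilon>))) (at u)"
    using wavelength_pos[OF assms, of \<alpha>] unfolding wave_def[abs_def] c_def
    by (auto intro!: derivative_eq_intros)
  moreover have "\<epsilon> * (c * (1 / wavelength \<alpha> \<epsilon>)) = slope \<alpha> \<epsilon> * c"
    using slope_wavelength[OF assms, of \<alpha>] wavelength_pos[OF assms, of \<alpha>] by (simp add: field_simps)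
  ultimately show ?thesis by (simp add: wave'_def c_def)
qed

lemma wave_bound: "\<epsilon> > 0 \<Longrightarrow> \<bar>wave \<alpha> \<epsilon> u\<bar> \<le> \<epsilon>"
  using abs_sin_le_one by (simp add: wave_def abs_mult mult_left_le)

lemma small_shear_wave:
  assumes "\<epsilon> > 0" "slope \<alpha> \<epsilon> \<le> 1/100"
  shows "small_shear (wave \<alpha> \<epsilon>) (wave' \<alpha> \<epsilon>)"
proof
  show "(wave \<alpha> \<epsilon> has_real_derivative wave' \<alpha> \<epsilon> u) (at u)" for u
    by (rule DERIV_wave[OF assms(1)])
  have "\<bar>wave' \<alpha> \<epsilon> u\<bar> \<le> slope \<alpha> \<epsilon>" for u
    using slope_pos[OF assms(1), of \<alpha>] abs_cos_le_one by (simp add: wave'_def abs_mult mult_left_le)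
  then show "\<bar>wave' \<alpha> \<epsilon> u\<bar> \<le> 1/100" for u
    using assms(2) order_trans by blast
  show "continuous_on UNIV (wave' \<alpha> \<epsilon>)"
    using wavelength_pos[OF assms(1), of \<alpha>] unfolding wave'_def[abs_def]
    by (intro continuous_intros) auto
qed

text \<open>The sum \<open>k + \<beta> = \<alpha>\<close> also holds for integral \<alpha>, where
  \<open>\<beta> = 1\<close>; it identifies the amplitude with \<open>d powr (k + \<beta>)\<close>.
  A positive order allows \<open>X\<close> to be differentiated once.\<close>

lemma holder_order_exponent:
  assumes "\<alpha> > 1"
  shows "holder_order \<alpha> > 0" "0 < holder_exponent \<alpha>" "holder_exponent \<alpha> \<le> 1"
    "real (holder_order \<alpha>) + holder_exponent \<alpha> = \<alpha>"
proof -
  have "holder_order \<alpha> > 0 \<and> 0 < holder_exponent \<alpha> \<and> holder_exponent \<alpha> \<le> 1 \<and>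
    real (holder_order \<alpha>) + holder_exponent \<alpha> = \<alpha>"
  proof (cases "\<alpha> \<in> \<int>")
    case True
    then obtain z where z: "\<alpha> = of_int z" by (auto elim: Ints_cases)
    then have "z \<ge> 2" using assms by simp
    then show ?thesis using z by (simp add: holder_order_def holder_exponent_def of_nat_diff)
  next
    case False
    have f: "\<lfloor>\<alpha>\<rfloor> \<ge> 1" using assms by (simp add: le_floor_iff)
    have "of_int \<lfloor>\<alpha>\<rfloor> \<noteq> \<alpha>" using False by (metis Ints_of_int)
    then have "of_int \<lfloor>\<alpha>\<rfloor> < \<alpha>" using of_int_floor_le[of \<alpha>] by linarith
    moreover have "\<alpha> - of_int \<lfloor>\<alpha>\<rfloor> \<le> 1" by linarith
    ultimately show ?thesis using False f by (simp add: holder_order_def holder_exponent_def)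
  qed
  then show "holder_order \<alpha> > 0" "0 < holder_exponent \<alpha>" "holder_exponent \<alpha> \<le> 1"
    "real (holder_order \<alpha>) + holder_exponent \<alpha> = \<alpha>" by blast+
qed

lemma holder_domain_interval:
  assumes "0 < \<beta>" "\<beta> \<le> 1" "r \<le> 1/2"
  shows "holder_domain \<beta> {-r<..<r}"
  by unfold_locales (use assms in auto)

lemma boundary_wave:
  assumes \<alpha>: "\<alpha> > 1" and \<epsilon>0: "\<And>\<epsilon>. \<epsilon> \<in> {0<..<\<epsilon>0} \<Longrightarrow> slope \<alpha> \<epsilon> \<le> 1/100 \<and> \<epsilon> \<le> 1"
  shows "\<exists>M>0. \<forall>\<epsilon>\<in>{0<..<\<epsilon>0}. boundary_in_C_alpha \<alpha> M (1/8) (sheared_disc (wave \<alpha> \<epsilon>))"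
proof -
  define k where "k = holder_order \<alpha>"
  define \<beta> where "\<beta> = holder_exponent \<alpha>"
  have k: "k > 0" "0 < \<beta>" "\<beta> \<le> 1" "real k + \<beta> = \<alpha>"
    using holder_order_exponent[OF \<alpha>] by (simp_all add: k_def \<beta>_def)
  define J where "J = {-(1/2)<..<1/2 :: real}"
  define S where "S = {-(1/8)<..<1/8 :: real}"
  \<comment> \<open>Indexing by parameter and base angle together makes one \<open>M\<close> serve
    all \<epsilon> and all boundary points.\<close>
  define P where "P = {0<..<\<epsilon>0} \<times> (UNIV :: real set)"
  define d where "d i = wavelength \<alpha> (fst i)" for i :: "real \<times> real"
  have hJ: "holder_domain \<beta> J" unfolding J_def by (rule holder_domain_interval) (use k in auto)
  have hS: "holder_domain \<beta> S" unfolding S_def by (rule holder_domain_interval) (use k in auto)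
  interpret J: holder_domain P \<beta> J by (rule hJ)
  define g where "g i = wave \<alpha> (fst i)" for i :: "real \<times> real"
  define g' where "g' i = wave' \<alpha> (fst i)" for i :: "real \<times> real"
  have \<epsilon>: "0 < fst i" "fst i \<le> 1" "slope \<alpha> (fst i) \<le> 1/100" if "i \<in> P" for i
    using that \<epsilon>0[of "fst i"] by (auto simp: P_def)
  have sh: "small_shear (g i) (g' i)" if "i \<in> P" for i
    unfolding g_def g'_def by (rule small_shear_wave) (use \<epsilon>[OF that] in auto)
  have d: "0 < d i \<and> d i \<le> 1" if "i \<in> P" for i
    using \<epsilon>[OF that] \<alpha> wavelength_pos by (auto simp: d_def wavelength_def intro!: powr_le1)
  note trig = J.trig[of k snd]
  \<comment> \<open>The decisive estimate: along the curve the wave is \<open>sin (q i t)\<close>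
    times \<epsilon>, which equals \<open>d i powr (k + \<beta>)\<close>, exactly the factor that
    \<open>scaled_oscillating\<close> compensates.\<close>
  have wave: "J.H k (\<lambda>i t. g i (cos (snd i + t)))"
  proof -
    define q where "q i t = (cos (snd i + t) - slope \<alpha> (fst i) / 4) / d i" for i :: "real \<times> real" and t
    have q: "(q i has_real_derivative - sin (snd i + t) / d i) (at t)" if "i \<in> P" for i t
      using d[OF that] unfolding q_def by (auto intro!: derivative_eq_intros)
    have s: "oscillating P d n 0 (\<lambda>i t. - sin (snd i + t))" for n
      by (rule oscillating_uminus[OF conjunct1[OF oscillating_trig[OF d]]])
    have q': "oscillating P d n 1 (\<lambda>i t. - sin (snd i + t) / d i)" for n
      using oscillating_divide[OF s] d by simp
    have o: "oscillating P d (Suc k) 0 (\<lambda>i t. sin (q i t))"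
      by (rule conjunct1[OF oscillating_sin_cos[OF q q']])
    have h: "J.H k (\<lambda>i t. d i powr (real k + \<beta>) * sin (q i t))"
      by (rule J.scaled_oscillating[OF _ o]) (use d in simp_all)
    have "d i powr (real k + \<beta>) * sin (q i t) = g i (cos (snd i + t))" if "i \<in> P" for i t
      using \<epsilon>[OF that] \<alpha> k(4)
      by (simp add: g_def wave_def q_def d_def wavelength_def powr_powr)
    then show ?thesis by (rule holder_family_cong[OF J.S(1) _ h])
  qed
  define nx where "nx i = small_shear.nx (g' i) (snd i)" for i
  define ny where "ny i = small_shear.ny (g' i) (snd i)" for i
  define X where "X i = small_shear.X (g i) (g' i) (snd i)" for i
  define X' where "X' i = small_shear.X' (g' i) (snd i)" for i
  define Y where "Y i = small_shear.Y (g i) (g' i) (snd i)" for i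
  define T where "T i = small_shear.T (g i) (g' i) (snd i)" for i
  have n: "\<bar>nx i\<bar> \<le> 1" "\<bar>ny i\<bar> \<le> 1" if "i \<in> P" for i
    using small_shear.unit_normal[OF sh[OF that]] by (auto simp: nx_def ny_def)
  have DX: "(X i has_real_derivative X' i t) (at t)" if "i \<in> P" for i t
    unfolding X_def X'_def by (rule small_shear.DERIV_X[OF sh[OF that]])
  have X'_ge: "X' i t \<ge> 1/2" if "i \<in> P" "t \<in> J" for i t
    unfolding X'_def using that(2) by (intro small_shear.X'_ge[OF sh[OF that(1)]]) (auto simp: J_def)
  have T: "T i s \<in> J \<and> X i (T i s) = s" if "i \<in> P" "s \<in> S" for i s
  proof -
    have "\<bar>s\<bar> < 1/8" using that(2) unfolding S_def by auto
    from small_shear.X_T[OF sh[OF that(1)] this, of "snd i"]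
    show ?thesis by (auto simp: T_def X_def J_def)
  qed
  have cn: "J.H k (\<lambda>i t. nx i)" "J.H k (\<lambda>i t. ny i)" "J.H k (\<lambda>i t. - ny i)"
    by (rule J.const[where C = 1], simp only: abs_minus_cancel n)+
  define z where "z i t = sin (snd i + t) + g i (cos (snd i + t))" for i t
  have z: "J.H k z" unfolding z_def by (rule J.add[OF conjunct1[OF trig] wave])
  \<comment> \<open>Collects the base point terms of \<open>X\<close>, constant in \<open>t\<close>,
    so that \<open>X\<close> is a sum of products of bounded families.\<close>
  define c where "c i = ny i * cos (snd i) - nx i * (sin (snd i) + g i (cos (snd i)))" for i
  have c: "\<bar>c i\<bar> \<le> 3" if "i \<in> P" for i
  proof -
    have "\<bar>ny i * cos (snd i)\<bar> \<le> 1 * 1"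
      unfolding abs_mult by (intro mult_mono) (use n[OF that] in auto)
    moreover have "\<bar>sin (snd i) + g i (cos (snd i))\<bar> \<le> 2"
      using abs_triangle_ineq[of "sin (snd i)" "g i (cos (snd i))"] abs_sin_le_one[of "snd i"]
        wave_bound[OF \<epsilon>(1)[OF that], of \<alpha> "cos (snd i)"] \<epsilon>(2)[OF that] unfolding g_def by linarith
    then have "\<bar>nx i * (sin (snd i) + g i (cos (snd i)))\<bar> \<le> 1 * 2"
      unfolding abs_mult by (intro mult_mono) (use n[OF that] in auto)
    ultimately show ?thesis unfolding c_def by linarith
  qed
  have X_eq: "X i t = (- ny i * cos (snd i + t) + nx i * z i t) + c i" if "i \<in> P" for i t
    unfolding X_def small_shear.X_def[OF sh[OF that]]
    by (simp add: nx_def ny_def z_def c_def algebra_simps)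
  have Y_eq: "Y i t = nx i * cos (snd i + t) + ny i * z i t" if "i \<in> P" for i t
    unfolding Y_def small_shear.Y_def[OF sh[OF that]]
    by (simp add: nx_def ny_def z_def)
  have "J.H k (\<lambda>i t. (- ny i * cos (snd i + t) + nx i * z i t) + c i)"
    by (intro J.add J.mult cn z conjunct2[OF trig] J.const[where C = 3] c)
  then have HX: "J.H k X" by (rule holder_family_cong[OF J.S(1), rotated]) (simp add: X_eq)
  have "J.H k (\<lambda>i t. nx i * cos (snd i + t) + ny i * z i t)"
    by (intro J.add J.mult cn z conjunct2[OF trig])
  then have HY: "J.H k Y" by (rule holder_family_cong[OF J.S(1), rotated]) (simp add: Y_eq)
  \<comment> \<open>\<open>X'\<close> has one order less than \<open>X\<close>; composition with the
    inverse of \<open>X\<close> still preserves order \<open>Suc m\<close>.\<close>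
  obtain m where m: "k = Suc m" using k(1) gr0_implies_Suc by blast
  have HX': "J.H m X'"
    by (rule holder_family_derivative[OF J.S(1) HX[unfolded m] DX])
  have "holder_family P \<beta> S k (\<lambda>i s. Y i (T i s))"
    by (rule holder_family_compose_inverse[OF hJ hS DX _ X'_ge T HX' _ HY]) (simp_all add: m)
  from holder_family_Ck_holder[OF holder_domain.S(1)[OF hS] k(2) this]
  obtain M where M: "M > 0" "\<And>i. i \<in> P \<Longrightarrow>
      Ck_holder_on k \<beta> S (\<lambda>s. Y i (T i s)) \<and> Ck_holder_norm k \<beta> S (\<lambda>s. Y i (T i s)) \<le> ennreal M"
    by blast
  have eq: "(\<lambda>s. Y (\<epsilon>, \<theta>) (T (\<epsilon>, \<theta>) s)) = (\<lambda>s. small_shear.Y (wave \<alpha> \<epsilon>) (wave' \<alpha> \<epsilon>) \<theta>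
      (small_shear.T (wave \<alpha> \<epsilon>) (wave' \<alpha> \<epsilon>) \<theta> s))" for \<epsilon> \<theta>
    by (simp add: Y_def T_def g_def g'_def)
  have "boundary_in_C_alpha \<alpha> M (1/8) (sheared_disc (wave \<alpha> \<epsilon>))" if "\<epsilon> \<in> {0<..<\<epsilon>0}" for \<epsilon>
    unfolding boundary_in_C_alpha_def
  proof (intro conjI ballI)
    have "(\<epsilon>, 0) \<in> P" using that by (simp add: P_def)
    from sh[OF this] interpret small_shear "wave \<alpha> \<epsilon>" "wave' \<alpha> \<epsilon>" by (simp add: g_def g'_def)
    show "open (sheared_disc (wave \<alpha> \<epsilon>))" by (rule open_sheared_disc[OF G_cont])
    fix x assume x: "x \<in> frontier (sheared_disc (wave \<alpha> \<epsilon>))"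
    obtain \<theta> where \<theta>: "x = curve \<theta>" by (rule frontier_curve[OF x])
    have i: "(\<epsilon>, \<theta>) \<in> P" using that by (simp add: P_def)
    have b: "ball 0 (1/8) = S" by (auto simp: S_def ball_def dist_real_def)
    have t: "norm (tangent \<theta>) = 1" "tangent \<theta> \<bullet> normal \<theta> = 0"
      using unit_normal(1)[of \<theta>] by (simp_all add: norm_vec2 inner_vec2 add.commute)
    have C: "C_alpha_on \<alpha> (ball 0 (1/8)) (\<lambda>s. Y (\<epsilon>, \<theta>) (T (\<epsilon>, \<theta>) s))"
      "C_alpha_norm \<alpha> (ball 0 (1/8)) (\<lambda>s. Y (\<epsilon>, \<theta>) (T (\<epsilon>, \<theta>) s)) \<le> ennreal M"
      using M(2)[OF i] unfolding C_alpha_on_def C_alpha_norm_def b k_def \<beta>_def by blast+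
    show "\<exists>\<nu> \<tau> \<psi>. outward_unit_normal (sheared_disc (wave \<alpha> \<epsilon>)) x \<nu> \<and> norm \<tau> = 1 \<and> \<tau> \<bullet> \<nu> = 0 \<and>
        C_alpha_on \<alpha> (ball 0 (1/8)) \<psi> \<and> C_alpha_norm \<alpha> (ball 0 (1/8)) \<psi> \<le> ennreal M \<and>
        ball x (1/8) \<inter> sheared_disc (wave \<alpha> \<epsilon>) =
          {y \<in> ball x (1/8). y \<bullet> \<nu> < \<psi> (tangent_projection \<nu> x y \<bullet> \<tau>)}"
      using outward_normal[OF x[unfolded \<theta>]] t C[unfolded eq] local_graph[of \<theta>] unfolding \<theta>
      by blast
  qed
  with M(1) show ?thesis by blast
qed

lemma smooth_family_wave:
  assumes "I \<subseteq> {0<..}" "open I" "\<And>\<epsilon>. \<epsilon> \<in> I \<Longrightarrow> slope \<alpha> \<epsilon> \<le> 1/100"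
  shows "smooth_set_family I (\<lambda>\<epsilon>. sheared_disc (wave \<alpha> \<epsilon>))"
proof -
  define W :: "(real \<times> (real^2)) set" where "W = I \<times> UNIV"
  have W: "open W" unfolding W_def using assms(2) by (intro open_Times) auto
  define F :: "real \<times> (real^2) \<Rightarrow> real" where
    "F z = (snd z $ 1)\<^sup>2 + (snd z $ 2 - wave \<alpha> (fst z) (snd z $ 1))\<^sup>2 - 1" for z
  \<comment> \<open>The phase as a combination of powers of \<epsilon>:
    \<open>slope / wavelength\<close> has exponent \<open>(1 - 1 / \<alpha>) - 1 / \<alpha>\<close>.
    Only sums and products occur, as in the closure rules, and the powers are smooth for
    \<open>\<epsilon> > 0\<close>.\<close>
  define E where "E z = snd z $ 1 * fst z powr (- 1 / \<alpha>) + (- 1 / 4) * fst z powr (1 - 2 / \<alpha>)"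
    for z :: "real \<times> (real^2)"
  define V where "V z = snd z $ 2 + (- 1) * (fst z * sin (E z))" for z :: "real \<times> (real^2)"
  have F_eq: "F z = snd z $ 1 * snd z $ 1 + V z * V z + (- 1)" if "z \<in> W" for z
  proof -
    have \<epsilon>: "fst z > 0" using that assms(1) by (auto simp: W_def)
    have "(snd z $ 1 - slope \<alpha> (fst z) / 4) / wavelength \<alpha> (fst z) = E z"
      using \<epsilon> by (simp add: E_def slope_def wavelength_def powr_minus_divide diff_divide_distrib
        flip: powr_diff)
    then show ?thesis by (simp add: F_def V_def wave_def power2_eq_square)
  qed
  have "Ck_on n W F" for n
  proof -
    have c: "Ck_on n W (\<lambda>z. c)" for c by (rule Ck_on_const[OF W])
    have p: "Ck_on n W (\<lambda>z. snd z $ j)" for j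
      by (rule Ck_on_linear[OF W])
        (intro bounded_linear_compose[OF bounded_linear_vec_nth bounded_linear_snd])
    have f: "Ck_on n W fst" by (rule Ck_on_linear[OF W bounded_linear_fst])
    have w: "Ck_on n W (\<lambda>z. fst z powr a)" for a
      by (rule Ck_on_powr[OF W f]) (use assms(1) in \<open>auto simp: W_def\<close>)
    have E: "Ck_on n W E" unfolding E_def
      by (intro Ck_on_add[OF W] Ck_on_mult[OF W] p w c)
    have s: "Ck_on n W (\<lambda>z. sin (E z))" using Ck_on_sin_cos[OF W E] ..
    have V: "Ck_on n W V" unfolding V_def
      by (intro Ck_on_add[OF W] Ck_on_mult[OF W] p s f c)
    have "Ck_on n W (\<lambda>z. snd z $ 1 * snd z $ 1 + V z * V z + (- 1))"
      by (intro Ck_on_add[OF W] Ck_on_mult[OF W] p V c)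
    then show ?thesis by (rule Ck_on_cong[OF W, rotated]) (simp add: F_eq)
  qed
  then have "smooth_on (I \<times> UNIV) F" by (simp add: smooth_on_def W_def)
  moreover have "sheared_disc (wave \<alpha> \<epsilon>) = {x. F (\<epsilon>, x) < 0}" for \<epsilon>
    by (simp add: sheared_disc_def F_def)
  moreover have "\<not> (GDERIV (\<lambda>y. F (\<epsilon>, y)) x :> 0)" if "\<epsilon> \<in> I" "F (\<epsilon>, x) = 0" for \<epsilon> x
  proof
    interpret small_shear "wave \<alpha> \<epsilon>" "wave' \<alpha> \<epsilon>"
      by (rule small_shear_wave) (use that assms in auto)
    define v where "v = (vector [2 * x $ 1 - 2 * (x $ 2 - wave \<alpha> \<epsilon> (x $ 1)) * wave' \<alpha> \<epsilon> (x $ 1),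
      2 * (x $ 2 - wave \<alpha> \<epsilon> (x $ 1))] :: real^2)"
    assume "GDERIV (\<lambda>y. F (\<epsilon>, y)) x :> 0"
    moreover have "GDERIV (\<lambda>y. F (\<epsilon>, y)) x :> v"
      unfolding F_def v_def using GDERIV_defining_function[of x] by simp
    ultimately have "(\<lambda>h. h \<bullet> v) = (\<lambda>h. h \<bullet> 0)"
      unfolding gderiv_def using has_derivative_unique by blast
    then have "v \<bullet> v = 0" by (metis inner_zero_right)
    then have "v = 0" by simp
    moreover have "v \<noteq> 0" unfolding v_def
      by (rule gradient_nonzero) (use that(2) in \<open>simp add: F_def\<close>)
    ultimately show False by simp
  qed
  ultimately show ?thesis unfolding smooth_set_family_def by (intro exI[of _ F]) blast
qed

text \<open>The shear moves each point by at most \<open>c\<close>, so the triangle inequality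
  compares the set with the unit disc.\<close>

lemma sheared_disc_between_balls:
  assumes "\<And>u. \<bar>G u\<bar> \<le> c"
  shows "ball 0 (1 - c) \<subseteq> sheared_disc G" "sheared_disc G \<subseteq> ball 0 (1 + c)"
proof -
  define v :: "real^2 \<Rightarrow> real^2" where "v x = G (x $ 1) *\<^sub>R axis 2 1" for x
  have v: "norm (v x) \<le> c" for x using assms by (simp add: v_def)
  have "x \<in> sheared_disc G \<longleftrightarrow> norm (x - v x) < 1" for x
    by (simp add: sheared_disc_def norm_vec2 v_def axis_def)
  then show "ball 0 (1 - c) \<subseteq> sheared_disc G" "sheared_disc G \<subseteq> ball 0 (1 + c)"
    using v norm_triangle_ineq4 norm_triangle_sub
    by (auto simp: dist_norm) (smt (verit) norm_triangle_ineq4 norm_triangle_sub)+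
qed

text \<open>At \<open>p\<close> the circle has slope
  \<open>- p / sqrt (1 - p\<^sup>2) \<ge> - 2 * p\<close>, as the root is at least 1/2, and the wave
  has slope \<open>4 * p\<close>. The upper boundary therefore ascends.\<close>

lemma critical_value_wave:
  assumes "\<epsilon> > 0" "slope \<alpha> \<epsilon> \<le> 1/100"
  shows "slope \<alpha> \<epsilon> / 4 \<le> critical_value (sheared_disc (wave \<alpha> \<epsilon>)) (axis 1 1)"
    and "critical_value (sheared_disc (wave \<alpha> \<epsilon>)) (axis 1 1) \<le> 1"
proof -
  define p where "p = slope \<alpha> \<epsilon> / 4"
  have p: "0 < p" "p \<le> 1/400" using slope_pos[OF assms(1), of \<alpha>] assms(2) by (auto simp: p_def)
  have "p\<^sup>2 \<le> (1/2)\<^sup>2" using p by (intro power_mono) auto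
  then have sq: "1 - p\<^sup>2 \<ge> 1/4" by (simp add: power2_eq_square)
  then have r: "sqrt (1 - p\<^sup>2) \<ge> 1/2" by (intro real_le_rsqrt) (simp add: power2_eq_square)
  have w: "wave' \<alpha> \<epsilon> p = 4 * p" by (simp add: wave'_def p_def)
  have "((\<lambda>u. sqrt (1 - u\<^sup>2)) has_real_derivative - p / sqrt (1 - p\<^sup>2)) (at p)"
    using sq by (auto intro!: derivative_eq_intros simp: field_simps)
  from DERIV_add[OF this DERIV_wave[OF assms(1)]]
  have d: "((\<lambda>u. sqrt (1 - u\<^sup>2) + wave \<alpha> \<epsilon> u) has_real_derivative - p / sqrt (1 - p\<^sup>2) + wave' \<alpha> \<epsilon> p) (at p)" .
  have "0 < sqrt (1 - p\<^sup>2)" using r by linarith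
  then have "p / sqrt (1 - p\<^sup>2) \<le> p / (1/2)" using p r by (intro divide_left_mono mult_pos_pos) auto
  then have "- p / sqrt (1 - p\<^sup>2) + wave' \<alpha> \<epsilon> p > 0" using p by (simp add: w)
  from critical_value_bounds[OF _ _ this d] p
  show "slope \<alpha> \<epsilon> / 4 \<le> critical_value (sheared_disc (wave \<alpha> \<epsilon>)) (axis 1 1)"
    and "critical_value (sheared_disc (wave \<alpha> \<epsilon>)) (axis 1 1) \<le> 1"
    by (auto simp: p_def)
qed

lemma ex_small_slope:
  assumes "\<alpha> > 1"
  shows "\<exists>\<epsilon>0>0. \<forall>\<epsilon>\<in>{0<..<\<epsilon>0}. slope \<alpha> \<epsilon> \<le> 1/100 \<and> \<epsilon> \<le> 1"
proof -
  define b where "b = 1 - 1 / \<alpha>"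
  have b: "b > 0" using assms by (simp add: b_def)
  define e where "e = min 1 ((1/100) powr (1 / b))"
  have "slope \<alpha> \<epsilon> \<le> 1/100" if "0 < \<epsilon>" "\<epsilon> < e" for \<epsilon>
  proof -
    have "\<epsilon> powr b \<le> ((1/100) powr (1 / b)) powr b"
      using that b by (intro powr_mono2) (auto simp: e_def)
    then show ?thesis using b by (simp add: slope_def b_def[symmetric] powr_powr)
  qed
  then show ?thesis by (intro exI[of _ e]) (auto simp: e_def)
qed

theorem theorem6p6:
  shows "\<exists>C1::real > 0. \<exists>C2::real \<Rightarrow> real. (\<forall>\<gamma>\<in>{0<..<1/4}. C2 \<gamma> > 0) \<and>
    (\<forall>\<alpha>::real > 1. \<exists>\<epsilon>0::real > 0. \<exists>\<Omega> :: real \<Rightarrow> (real^2) set.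
       smooth_set_family {0<..<\<epsilon>0} \<Omega> \<and>
       (\<forall>\<epsilon>\<in>{0<..<\<epsilon>0}. open (\<Omega> \<epsilon>) \<and> bounded (\<Omega> \<epsilon>)) \<and>
       (\<exists>M>0. \<forall>\<epsilon>\<in>{0<..<\<epsilon>0}. boundary_in_C_alpha \<alpha> M (1/8) (\<Omega> \<epsilon>)) \<and>
       (\<forall>\<epsilon>\<in>{0<..<\<epsilon>0}. ball 0 (1 - C1 * \<epsilon>) \<subseteq> \<Omega> \<epsilon> \<and> \<Omega> \<epsilon> \<subseteq> ball 0 (1 + C1 * \<epsilon>)) \<and>
       (\<forall>\<gamma>\<in>{0<..<1/4}. \<forall>\<^sub>F \<epsilon> in at_right 0.
          let e1 = axis 1 1; l = critical_value (\<Omega> \<epsilon>) e1; \<Omega>' = reflection e1 l ` \<Omega> \<epsilon>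
          in measure lebesgue
               {x \<in> sym_diff (\<Omega> \<epsilon>) \<Omega>'. infdist x (hyperplane e1 l) \<le> \<gamma>}
             \<ge> C2 \<gamma> * \<epsilon> powr (1 - 1 / \<alpha>)))"
proof (rule exI[of _ 1], intro conjI, simp, rule exI[of _ "\<lambda>\<gamma>. \<gamma>\<^sup>2 / 8"], intro conjI allI impI)
  fix \<alpha> :: real assume \<alpha>: "\<alpha> > 1"
  obtain \<epsilon>0 where \<epsilon>0: "\<epsilon>0 > 0" "\<And>\<epsilon>. \<epsilon> \<in> {0<..<\<epsilon>0} \<Longrightarrow> slope \<alpha> \<epsilon> \<le> 1/100 \<and> \<epsilon> \<le> 1"
    using ex_small_slope[OF \<alpha>] by blast
  define \<Omega> where "\<Omega> \<epsilon> = sheared_disc (wave \<alpha> \<epsilon>)" for \<epsilon>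
  have cont: "continuous_on UNIV (wave \<alpha> \<epsilon>)" if "\<epsilon> \<in> {0<..<\<epsilon>0}" for \<epsilon>
    using that DERIV_wave by (meson DERIV_continuous continuous_at_imp_continuous_on greaterThanLessThan_iff)
  have bd: "\<bar>wave \<alpha> \<epsilon> u\<bar> \<le> \<epsilon>" if "\<epsilon> \<in> {0<..<\<epsilon>0}" for \<epsilon> u
    using that wave_bound by simp
  have 1: "smooth_set_family {0<..<\<epsilon>0} \<Omega>"
    unfolding \<Omega>_def by (rule smooth_family_wave) (use \<epsilon>0(2) in auto)
  have 2: "open (\<Omega> \<epsilon>)" "bounded (\<Omega> \<epsilon>)" "ball 0 (1 - 1 * \<epsilon>) \<subseteq> \<Omega> \<epsilon>" "\<Omega> \<epsilon> \<subseteq> ball 0 (1 + 1 * \<epsilon>)"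
    if "\<epsilon> \<in> {0<..<\<epsilon>0}" for \<epsilon>
    unfolding \<Omega>_def mult_1
    by (rule open_sheared_disc cont[OF that] bounded_sheared_disc bd[OF that] sheared_disc_between_balls)+
  have 3: "\<exists>M>0. \<forall>\<epsilon>\<in>{0<..<\<epsilon>0}. boundary_in_C_alpha \<alpha> M (1/8) (\<Omega> \<epsilon>)"
    unfolding \<Omega>_def by (rule boundary_wave[OF \<alpha> \<epsilon>0(2)])
  have 4: "\<gamma>\<^sup>2 / 8 * \<epsilon> powr (1 - 1 / \<alpha>) \<le> measure lebesgue {x \<in> sym_diff (\<Omega> \<epsilon>)
      (reflection (axis 1 1) (critical_value (\<Omega> \<epsilon>) (axis 1 1)) ` \<Omega> \<epsilon>).
      infdist x (hyperplane (axis 1 1) (critical_value (\<Omega> \<epsilon>) (axis 1 1))) \<le> \<gamma>}"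
    if \<epsilon>: "\<epsilon> \<in> {0<..<\<epsilon>0}" and \<gamma>: "\<gamma> \<in> {0<..<1/4}" for \<epsilon> \<gamma>
  proof -
    define l where "l = critical_value (\<Omega> \<epsilon>) (axis 1 1)"
    have l: "slope \<alpha> \<epsilon> / 4 \<le> l" "l \<le> 1"
      using critical_value_wave[of \<epsilon> \<alpha>] \<epsilon>0(2)[OF \<epsilon>] \<epsilon> by (auto simp: l_def \<Omega>_def)
    have l0: "0 < l" using l(1) slope_pos[of \<epsilon> \<alpha>] \<epsilon> by simp
    \<comment> \<open>The constant combines the quarter in \<open>p = slope / 4\<close> with the
      factor \<open>\<gamma>\<^sup>2 / 2\<close> of the section estimate; it is free of
      \<alpha>.\<close>
    have "\<gamma>\<^sup>2 / 8 * \<epsilon> powr (1 - 1 / \<alpha>) = slope \<alpha> \<epsilon> / 4 * \<gamma>\<^sup>2 / 2" by (simp add: slope_def)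
    also have "\<dots> \<le> l * \<gamma>\<^sup>2 / 2" using l(1) by (intro divide_right_mono mult_right_mono) auto
    also have "\<dots> \<le> measure lebesgue {x \<in> sym_diff (\<Omega> \<epsilon>) (reflection (axis 1 1) l ` \<Omega> \<epsilon>).
        infdist x (hyperplane (axis 1 1) l) \<le> \<gamma>}"
      unfolding \<Omega>_def using \<gamma> by (intro symdiff_measure_ge[OF cont[OF \<epsilon>] bd[OF \<epsilon>] l0 l(2)]) auto
    finally show ?thesis unfolding l_def .
  qed
  have 5: "\<forall>\<^sub>F \<epsilon> in at_right 0. \<epsilon> \<in> {0<..<\<epsilon>0}"
    using eventually_at_right_real[OF \<epsilon>0(1)] .
  show "\<exists>\<epsilon>0::real > 0. \<exists>\<Omega> :: real \<Rightarrow> (real^2) set.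
       smooth_set_family {0<..<\<epsilon>0} \<Omega> \<and>
       (\<forall>\<epsilon>\<in>{0<..<\<epsilon>0}. open (\<Omega> \<epsilon>) \<and> bounded (\<Omega> \<epsilon>)) \<and>
       (\<exists>M>0. \<forall>\<epsilon>\<in>{0<..<\<epsilon>0}. boundary_in_C_alpha \<alpha> M (1/8) (\<Omega> \<epsilon>)) \<and>
       (\<forall>\<epsilon>\<in>{0<..<\<epsilon>0}. ball 0 (1 - 1 * \<epsilon>) \<subseteq> \<Omega> \<epsilon> \<and> \<Omega> \<epsilon> \<subseteq> ball 0 (1 + 1 * \<epsilon>)) \<and>
       (\<forall>\<gamma>\<in>{0<..<1/4}. \<forall>\<^sub>F \<epsilon> in at_right 0.
          let e1 = axis 1 1; l = critical_value (\<Omega> \<epsilon>) e1; \<Omega>' = reflection e1 l ` \<Omega> \<epsilon>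
          in measure lebesgue
               {x \<in> sym_diff (\<Omega> \<epsilon>) \<Omega>'. infdist x (hyperplane e1 l) \<le> \<gamma>}
             \<ge> \<gamma>\<^sup>2 / 8 * \<epsilon> powr (1 - 1 / \<alpha>))"
    unfolding Let_def
    by (intro exI[of _ \<epsilon>0] exI[of _ \<Omega>] conjI ballI \<epsilon>0(1) 1 2 3 eventually_mono[OF 5] 4)
qed auto

end
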